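(* The relaxation of the multi-capacitated lot-sizing problem given by optimizing a linear objective over $$\mathcal{P}^{\mathrm{MCMIX}}=\{(w,\mathbf{y},\mathbf{x})\in\mathbb{R}\times\mathbb{R}^n_+\times\{0,1\}^n: w\ge q_i-c_ix_i-y_i\ \forall i\in\{1,\dots,n\}\}$$ (given $n$, $\mathbf{q}\in\mathbb{R}^n$, $\mathbf{c}\in\mathbb{R}^n_+$ and a linear objective function in $(w,\mathbf{y},\mathbf{x})$) is solvable in polynomial time.
   Context: Polynomial time is meant in the standard sense: for rational input data ($\mathbf{q}$, $\mathbf{c}$ and the objective coefficients), the running time is polynomial in the encoding length of the input; no divisibility or other restriction is placed on $\mathbf{c}$. Solving the problem means finding an optimal solution or determining that the objective is unbounded over $\mathcal{P}^{\mathrm{MCMIX}}$. *)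

theory Defs
  imports Complex_Main "HOL-Library.Log_Nat" "HOL-Computational_Algebra.Polynomial"
begin

section \<open>Random access machines with logarithmic cost\<close>

text \<open>
  The model of computation is the random access machine of Cook and Reckhow with integer
  registers \<open>X\<^sub>i\<close>, extended by multiplication as in Aho, Hopcroft and Ullman, under the
  logarithmic cost criterion: an instruction is charged the bit lengths of all integers
  (data and indirect addresses) it handles. It is polynomially equivalent to deterministic
  Turing machines. Registers are indexed by all integers, so that indirect addressing is total.
\<close>

definition int_size :: "int \<Rightarrow> nat" where
  "int_size k = 1 + nat (bitlen \<bar>k\<bar>)"  \<comment> \<open>sign bit and binary digits of the absolute value\<close>

definition code_size :: "int list \<Rightarrow> nat" where
  "code_size ks = (\<Sum>k\<leftarrow>ks. int_size k)"

datatype instr =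
    SetI int int        \<comment> \<open>\<open>X\<^sub>i := k\<close>\<close>
  | AddI int int int    \<comment> \<open>\<open>X\<^sub>i := X\<^sub>j + X\<^sub>k\<close>\<close>
  | SubI int int int    \<comment> \<open>\<open>X\<^sub>i := X\<^sub>j - X\<^sub>k\<close>\<close>
  | MulI int int int    \<comment> \<open>\<open>X\<^sub>i := X\<^sub>j * X\<^sub>k\<close>\<close>
  | LoadI int int       \<comment> \<open>\<open>X\<^sub>i := X\<^sub>a\<close> where \<open>a = X\<^sub>j\<close>\<close>
  | StoreI int int      \<comment> \<open>\<open>X\<^sub>a := X\<^sub>j\<close> where \<open>a = X\<^sub>i\<close>\<close>
  | JumpI nat           \<comment> \<open>continue with instruction \<open>m\<close>\<close>
  | JumpPosI int nat    \<comment> \<open>continue with instruction \<open>m\<close> if \<open>X\<^sub>i > 0\<close>\<close>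
  | ReadI int           \<comment> \<open>move the next input integer to \<open>X\<^sub>i\<close>\<close>
  | WriteI int          \<comment> \<open>append \<open>X\<^sub>i\<close> to the output\<close>

text \<open>A configuration consists of program counter, registers, remaining input, and output.\<close>

type_synonym config = "nat \<times> (int \<Rightarrow> int) \<times> int list \<times> int list"

text \<open>Reading from an exhausted input yields 0.\<close>

definition next_input :: "int list \<Rightarrow> int" where
  "next_input inp = (case inp of [] \<Rightarrow> 0 | k # _ \<Rightarrow> k)"

fun instr_exec :: "instr \<Rightarrow> config \<Rightarrow> config" where
  "instr_exec (SetI i k) (pc, X, inp, out) = (pc + 1, X(i := k), inp, out)"
| "instr_exec (AddI i j k) (pc, X, inp, out) = (pc + 1, X(i := X j + X k), inp, out)"
| "instr_exec (SubI i j k) (pc, X, inp, out) = (pc + 1, X(i := X j - X k), inp, out)"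
| "instr_exec (MulI i j k) (pc, X, inp, out) = (pc + 1, X(i := X j * X k), inp, out)"
| "instr_exec (LoadI i j) (pc, X, inp, out) = (pc + 1, X(i := X (X j)), inp, out)"
| "instr_exec (StoreI i j) (pc, X, inp, out) = (pc + 1, X(X i := X j), inp, out)"
| "instr_exec (JumpI m) (pc, X, inp, out) = (m, X, inp, out)"
| "instr_exec (JumpPosI i m) (pc, X, inp, out) = (if X i > 0 then m else pc + 1, X, inp, out)"
| "instr_exec (ReadI i) (pc, X, inp, out) = (pc + 1, X(i := next_input inp), tl inp, out)"
| "instr_exec (WriteI i) (pc, X, inp, out) = (pc + 1, X, inp, out @ [X i])"

fun instr_cost :: "instr \<Rightarrow> config \<Rightarrow> nat" where
  "instr_cost (SetI i k) (pc, X, inp, out) = int_size k"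
| "instr_cost (AddI i j k) (pc, X, inp, out) = int_size (X j) + int_size (X k)"
| "instr_cost (SubI i j k) (pc, X, inp, out) = int_size (X j) + int_size (X k)"
| "instr_cost (MulI i j k) (pc, X, inp, out) = int_size (X j) + int_size (X k)"
| "instr_cost (LoadI i j) (pc, X, inp, out) = int_size (X j) + int_size (X (X j))"
| "instr_cost (StoreI i j) (pc, X, inp, out) = int_size (X i) + int_size (X j)"
| "instr_cost (JumpI m) (pc, X, inp, out) = 1"
| "instr_cost (JumpPosI i m) (pc, X, inp, out) = int_size (X i)"
| "instr_cost (ReadI i) (pc, X, inp, out) = int_size (next_input inp)"
| "instr_cost (WriteI i) (pc, X, inp, out) = int_size (X i)"

inductive ram_run :: "instr list \<Rightarrow> config \<Rightarrow> nat \<Rightarrow> config \<Rightarrow> bool" for P where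
  refl: "ram_run P s 0 s"
| step: "fst s < length P \<Longrightarrow> ram_run P (instr_exec (P ! fst s) s) t s' \<Longrightarrow>
         ram_run P s (instr_cost (P ! fst s) s + t) s'"

text \<open>
  The machine starts with all registers 0 and halts when the program counter leaves the program.
\<close>

definition ram_computes :: "instr list \<Rightarrow> int list \<Rightarrow> nat \<Rightarrow> int list \<Rightarrow> bool" where
  "ram_computes P inp t out \<longleftrightarrow>
     (\<exists>pc X inp'. ram_run P (0, (\<lambda>_. 0), inp, []) t (pc, X, inp', out) \<and> length P \<le> pc)"

text \<open>
  A search problem is given by its instances, the codes of instances and of answers (an object
  may have several codes), and the relation that says which answers solve which instance.
  It is solvable in polynomial time if a single program, on every code of every instance, outputs
  a code of a solution within time polynomial in the length of the input code.
\<close>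

definition poly_time_solvable ::
  "'a set \<Rightarrow> ('a \<Rightarrow> int list \<Rightarrow> bool) \<Rightarrow> ('b \<Rightarrow> int list \<Rightarrow> bool) \<Rightarrow> ('a \<Rightarrow> 'b \<Rightarrow> bool) \<Rightarrow> bool" where
  "poly_time_solvable instances in_code out_code solves \<longleftrightarrow>
     (\<exists>(P :: instr list) (p :: nat poly). \<forall>a\<in>instances. \<forall>inp. in_code a inp \<longrightarrow>
        (\<exists>t out b. ram_computes P inp t out \<and> t \<le> poly p (code_size inp) \<and>
                   out_code b out \<and> solves a b))"

text \<open>Rationals are written as fractions with positive denominator, not necessarily reduced.\<close>

definition rats_code :: "rat list \<Rightarrow> int list \<Rightarrow> bool" where
  "rats_code rs ks \<longleftrightarrow>
     (\<exists>fs :: (int \<times> int) list. (\<forall>(a, d) \<in> set fs. d > 0) \<and>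
        rs = map (\<lambda>(a, d). Fract a d) fs \<and> ks = concat (map (\<lambda>(a, d). [a, d]) fs))"


section \<open>Linear optimization over the multi-capacity mixing set\<close>

text \<open>Vectors with \<open>n\<close> entries are lists of length \<open>n\<close>, indexed from 0.\<close>

definition P_MCMIX :: "nat \<Rightarrow> real list \<Rightarrow> real list \<Rightarrow> (real \<times> real list \<times> real list) set" where
  "P_MCMIX n q c = {(w, y, x). length y = n \<and> length x = n \<and>
     (\<forall>i<n. y ! i \<ge> 0) \<and> (\<forall>i<n. x ! i \<in> {0, 1}) \<and>
     (\<forall>i<n. w \<ge> q ! i - c ! i * x ! i - y ! i)}"

text \<open>The objective is \<open>obj_w * w + obj_y \<bullet> y + obj_x \<bullet> x\<close>.\<close>

record mcmix_instance =
  dimen :: nat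
  demand :: "rat list"
  capacity :: "rat list"
  obj_w :: rat
  obj_y :: "rat list"
  obj_x :: "rat list"

definition mcmix_instances :: "mcmix_instance set" where
  "mcmix_instances = {I.
     length (demand I) = dimen I \<and> length (capacity I) = dimen I \<and>
     length (obj_y I) = dimen I \<and> length (obj_x I) = dimen I \<and>
     (\<forall>i<dimen I. capacity I ! i \<ge> 0)}"

definition mcmix_feasible :: "mcmix_instance \<Rightarrow> (real \<times> real list \<times> real list) set" where
  "mcmix_feasible I = P_MCMIX (dimen I) (map of_rat (demand I)) (map of_rat (capacity I))"

fun mcmix_objective :: "mcmix_instance \<Rightarrow> real \<times> real list \<times> real list \<Rightarrow> real" where
  "mcmix_objective I (w, y, x) = of_rat (obj_w I) * w +
     (\<Sum>i<dimen I. of_rat (obj_y I ! i) * y ! i) + (\<Sum>i<dimen I. of_rat (obj_x I ! i) * x ! i)"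

datatype mcmix_answer = Unbounded | Optimal rat "rat list" "rat list"

text \<open>
  The objective is minimized; as its coefficients have arbitrary sign, this covers maximization.
  Optimality and unboundedness refer to all real points of the feasible set.
\<close>

fun mcmix_solves :: "mcmix_instance \<Rightarrow> mcmix_answer \<Rightarrow> bool" where
  "mcmix_solves I Unbounded \<longleftrightarrow> (\<forall>B. \<exists>z\<in>mcmix_feasible I. mcmix_objective I z < B)"
| "mcmix_solves I (Optimal w y x) \<longleftrightarrow>
     (let s = (of_rat w, map of_rat y, map of_rat x) in
        s \<in> mcmix_feasible I \<and> (\<forall>z\<in>mcmix_feasible I. mcmix_objective I s \<le> mcmix_objective I z))"

definition mcmix_instance_code :: "mcmix_instance \<Rightarrow> int list \<Rightarrow> bool" where
  "mcmix_instance_code I ks \<longleftrightarrow>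
     (\<exists>ls. ks = int (dimen I) # ls \<and>
           rats_code (demand I @ capacity I @ [obj_w I] @ obj_y I @ obj_x I) ls)"

fun mcmix_answer_code :: "mcmix_answer \<Rightarrow> int list \<Rightarrow> bool" where
  "mcmix_answer_code Unbounded ks \<longleftrightarrow> ks = [0]"
| "mcmix_answer_code (Optimal w y x) ks \<longleftrightarrow> (\<exists>ls. ks = 1 # ls \<and> rats_code (w # y @ x) ls)"

end

theory Submission
  imports Defs
begin

text \<open>
  The problem is unbounded if \<open>a < 0\<close>, some \<open>b i < 0\<close> or \<open>a > (\<Sum>i. b i)\<close>, where \<open>a\<close> and
  \<open>b\<close> are the objective coefficients of \<open>w\<close> and \<open>y\<close>. Otherwise, for fixed \<open>w\<close> it separates:
  item \<open>i\<close> contributes the smaller of the costs for \<open>x i = 0\<close> and \<open>x i = 1\<close>, with \<open>y i\<close>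
  as small as possible. For fixed \<open>x\<close> the remaining function of \<open>w\<close> is convex and piecewise linear
  with breakpoints among the numbers \<open>q i\<close> and \<open>q i - c i\<close>, and it attains its minimum at one of
  them. Hence it suffices to compare linearly many values of \<open>w\<close>.

  All numbers are brought to a common denominator, the product of the given denominators. Its bit
  length is at most the length of the input, so all integers occurring in the computation have
  linear bit length, and the number of steps is quadratic.
\<close>

section \<open>Structured programs and their correctness with resource bounds\<close>

text \<open>Under logarithmic cost a count of instructions does not bound the time, because repeated
  multiplication can make numbers exponentially long. So one bound \<open>B\<close> for all
  registers and input integers is fixed in advance; every instruction then costs at most
  \<open>2 * int_size B\<close>, and time becomes an instruction count times this unit. For input
  size \<open>S\<close> the scaled data are at most M = 2^S. Products of two scaled numbers have
  order M^2, sums of up to n of them order M^3. The factor 32 leaves room for the difference of two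
  objective values and turns 32 M^3 into the power 2^(3S+5). The denominators are multiplied rather
  than reduced to a least common multiple: the machine has no division, and each scaled numerator is
  again a product with one factor per fraction, so it obeys the same bound as the
  denominator.\<close>

lemma int_size_mono: "\<bar>v\<bar> \<le> B \<Longrightarrow> int_size v \<le> int_size B"
  by (simp add: int_size_def bitlen_def floorlog_mono)

lemma int_size_pos: "1 \<le> int_size v"
  by (simp add: int_size_def)

section \<open>Structured programs and their compilation\<close>

type_synonym state = "(int \<Rightarrow> int) \<times> int list \<times> int list"

datatype com =
    Skip
  | Do instr
  | Seq com com (infixr \<open>;;\<close> 60)
  | Cond int com com
  | Loop int com

fun csize :: "com \<Rightarrow> nat" where
  "csize Skip = 0"
| "csize (Do ins) = 1"
| "csize (c ;; d) = csize c + csize d"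
| "csize (Cond i c d) = csize c + csize d + 2"
| "csize (Loop i c) = csize c + 3"

text \<open>Jump targets are absolute, hence the start position \<open>p\<close>. The only test
  falls through when the register is not positive, so \<open>Cond\<close> lays out its else branch
  first and \<open>Loop\<close> jumps over its own exit jump.\<close>

fun compile :: "nat \<Rightarrow> com \<Rightarrow> instr list" where
  "compile p Skip = []"
| "compile p (Do ins) = [ins]"
| "compile p (c ;; d) = compile p c @ compile (p + csize c) d"
| "compile p (Cond i c d) =
     [JumpPosI i (p + csize d + 2)] @ compile (p + 1) d @
     [JumpI (p + csize d + 2 + csize c)] @ compile (p + csize d + 2) c"
| "compile p (Loop i c) =
     [JumpPosI i (p + 2), JumpI (p + csize c + 3)] @ compile (p + 2) c @ [JumpI p]"

lemma length_compile [simp]: "length (compile p c) = csize c"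
  by (induction c arbitrary: p) auto

text \<open>Upper bound for the number of executed instructions if no loop is iterated more than \<open>N\<close> times.\<close>

fun steps :: "nat \<Rightarrow> com \<Rightarrow> nat" where
  "steps N Skip = 0"
| "steps N (Do ins) = 1"
| "steps N (c ;; d) = steps N c + steps N d"
| "steps N (Cond i c d) = steps N c + steps N d + 2"
| "steps N (Loop i c) = N * (steps N c + 2) + 2"

text \<open>Adding the two branches of \<open>Cond\<close> instead of taking their maximum keeps the
  bound polynomial; its degree is at most the nesting depth of the loops.\<close>

lemma steps_poly: "\<exists>p. \<forall>N. steps N c = poly p N"
proof (induction c)
  case Skip
  show ?case by (rule exI[of _ 0]) simp
next
  case (Do ins)
  show ?case by (rule exI[of _ 1]) simp
next
  case (Seq c d)
  then obtain p q where "\<forall>N. steps N c = poly p N" "\<forall>N. steps N d = poly q N" by blast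
  then show ?case by (intro exI[of _ "p + q"]) simp
next
  case (Cond i c d)
  then obtain p q where "\<forall>N. steps N c = poly p N" "\<forall>N. steps N d = poly q N" by blast
  then show ?case by (intro exI[of _ "p + q + [:2:]"]) simp
next
  case (Loop i c)
  then obtain p where "\<forall>N. steps N c = poly p N" by blast
  then show ?case by (intro exI[of _ "pCons 2 (p + [:2:])"]) simp
qed

section \<open>Execution of embedded code, measured in instructions\<close>

definition code_at :: "instr list \<Rightarrow> nat \<Rightarrow> instr list \<Rightarrow> bool" where
  "code_at P p cs \<longleftrightarrow> (\<exists>pre post. P = pre @ cs @ post \<and> length pre = p)"

lemma code_at_append:
  "code_at P p (cs @ ds) \<longleftrightarrow> code_at P p cs \<and> code_at P (p + length cs) ds"
proof
  assume "code_at P p (cs @ ds)"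
  then obtain pre post where "P = pre @ cs @ ds @ post" "length pre = p"
    by (auto simp: code_at_def)
  then show "code_at P p cs \<and> code_at P (p + length cs) ds"
    unfolding code_at_def by (metis append.assoc length_append)
next
  assume "code_at P p cs \<and> code_at P (p + length cs) ds"
  then obtain pre post pre' post' where 1: "P = pre @ cs @ post" "length pre = p"
    and 2: "P = pre' @ ds @ post'" "length pre' = p + length cs"
    unfolding code_at_def by blast
  then have "(pre @ cs) @ post = pre' @ (ds @ post')" "length (pre @ cs) = length pre'" by auto
  then have "post = ds @ post'" by (metis append_eq_append_conv)
  then show "code_at P p (cs @ ds)" using 1 by (auto simp: code_at_def)
qed

lemma code_at_Cons:
  "code_at P p (ins # cs) \<longleftrightarrow> code_at P p [ins] \<and> code_at P (Suc p) cs"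
  using code_at_append[of P p "[ins]" cs] by simp

lemma code_at_single: "code_at P p [ins] \<Longrightarrow> p < length P \<and> P ! p = ins"
  by (auto simp: code_at_def nth_append)

lemma ram_run_trans:
  assumes "ram_run P s t s'" "ram_run P s' t' s''"
  shows "ram_run P s (t + t') s''"
  using assms by (induction rule: ram_run.induct) (auto simp: add.assoc intro: ram_run.intros)

text \<open>The output is left unconstrained: no instruction reads it back, and
  \<open>WriteI\<close> is charged for a register.\<close>

fun bounded :: "int \<Rightarrow> state \<Rightarrow> bool" where
  "bounded B (X, inp, out) \<longleftrightarrow> 0 \<le> B \<and> (\<forall>k. \<bar>X k\<bar> \<le> B) \<and> (\<forall>v\<in>set inp. \<bar>v\<bar> \<le> B)"

text \<open>At most two integers are charged. They come from registers or the input, except for the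
  constant of \<open>SetI\<close>, which needs its own hypothesis.\<close>

lemma instr_cost_le:
  assumes "bounded B s" "\<And>i k. ins = SetI i k \<Longrightarrow> \<bar>k\<bar> \<le> B"
  shows "instr_cost ins (p, s) \<le> 2 * int_size B"
proof -
  obtain X inp out where s: "s = (X, inp, out)" by (cases s)
  have X: "int_size (X k) \<le> int_size B" for k
    using assms(1) by (auto simp: s intro: int_size_mono)
  have XX: "int_size (X j) + int_size (X k) \<le> 2 * int_size B" for j k
    using X[of j] X[of k] by simp
  have inp: "int_size (next_input inp) \<le> int_size B"
    using assms(1) by (intro int_size_mono) (auto simp: s next_input_def split: list.split)
  have set: "ins = SetI i k \<Longrightarrow> int_size k \<le> int_size B" for i k
    using assms(2) by (auto intro: int_size_mono)
  show ?thesis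
    using X XX inp set int_size_pos[of B] by (cases ins) (auto simp: s intro: trans_le_add1 simp: mult_2)
qed

text \<open>Allotting every instruction the same worst-case cost makes composition a mere addition
  of the counts \<open>k\<close>.\<close>

definition reaches :: "instr list \<Rightarrow> int \<Rightarrow> config \<Rightarrow> nat \<Rightarrow> config \<Rightarrow> bool" where
  "reaches P B s k s' \<longleftrightarrow> (\<exists>t \<le> k * (2 * int_size B). ram_run P s t s')"

lemma reaches_refl: "reaches P B s k s"
  unfolding reaches_def by (auto intro: ram_run.refl)

lemma reaches_trans:
  "reaches P B s k s' \<Longrightarrow> reaches P B s' l s'' \<Longrightarrow> reaches P B s (k + l) s''"
  unfolding reaches_def by (metis add_mono add_mult_distrib ram_run_trans)

lemma reaches_mono: "reaches P B s k s' \<Longrightarrow> k \<le> l \<Longrightarrow> reaches P B s l s'"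
  unfolding reaches_def by (meson le_trans mult_le_mono1)

lemma reaches_instr:
  assumes "code_at P p [ins]" "bounded B s" "\<And>i k. ins = SetI i k \<Longrightarrow> \<bar>k\<bar> \<le> B"
  shows "reaches P B (p, s) 1 (instr_exec ins (p, s))"
proof -
  have "ram_run P (p, s) (instr_cost ins (p, s) + 0) (instr_exec ins (p, s))"
    using ram_run.step[of "(p, s)" P 0, OF _ ram_run.refl] code_at_single[OF assms(1)] by simp
  then show ?thesis
    unfolding reaches_def using instr_cost_le[of B s ins p, OF assms(2)] assms(3) by auto
qed

text \<open>
  Total correctness with resource bounds: all integers in the registers and on the input
  stay bounded by \<open>B\<close>, and loops make at most \<open>N\<close> iterations.
\<close>

definition ht :: "nat \<Rightarrow> int \<Rightarrow> (state \<Rightarrow> bool) \<Rightarrow> com \<Rightarrow> (state \<Rightarrow> bool) \<Rightarrow> bool" where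
  "ht N B P c Q \<longleftrightarrow> (\<forall>prog p s. code_at prog p (compile p c) \<and> P s \<and> bounded B s \<longrightarrow>
     (\<exists>s'. reaches prog B (p, s) (steps N c) (p + csize c, s') \<and> Q s' \<and> bounded B s'))"

lemma ht_conseq:
  "ht N B P c Q \<Longrightarrow> (\<And>s. P' s \<Longrightarrow> P s) \<Longrightarrow> (\<And>s. Q s \<Longrightarrow> Q' s) \<Longrightarrow> ht N B P' c Q'"
  unfolding ht_def by meson

lemma ht_Seq:
  assumes "ht N B P c Q" "ht N B Q d R"
  shows "ht N B P (c ;; d) R"
  unfolding ht_def
proof (intro allI impI, elim conjE)
  fix prog p s assume *: "code_at prog p (compile p (c ;; d))" "P s" "bounded B s"
  then have cd: "code_at prog p (compile p c)" "code_at prog (p + csize c) (compile (p + csize c) d)"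
    by (auto simp: code_at_append)
  obtain s' where 1: "reaches prog B (p, s) (steps N c) (p + csize c, s')" "Q s'" "bounded B s'"
    using assms(1) cd(1) * unfolding ht_def by blast
  obtain s'' where 2: "reaches prog B (p + csize c, s') (steps N d) (p + csize c + csize d, s'')"
      "R s''" "bounded B s''"
    using assms(2) cd(2) 1 unfolding ht_def by blast
  show "\<exists>s'. reaches prog B (p, s) (steps N (c ;; d)) (p + csize (c ;; d), s') \<and> R s' \<and> bounded B s'"
    using reaches_trans[OF 1(1) 2(1)] 2(2,3) by (intro exI[of _ s'']) (simp add: add.assoc)
qed

lemma ht_Skip: "ht N B P Skip P"
  unfolding ht_def by (auto intro: reaches_refl)

lemma ht_Cond:
  assumes c: "ht N B (\<lambda>s. P s \<and> fst s i > 0) c Q" and d: "ht N B (\<lambda>s. P s \<and> \<not> fst s i > 0) d Q"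
  shows "ht N B P (Cond i c d) Q"
  unfolding ht_def
proof (intro allI impI, elim conjE)
  fix prog p s assume *: "code_at prog p (compile p (Cond i c d))" "P s" "bounded B s"
  obtain X inp out where s: "s = (X, inp, out)" by (cases s)
  from *(1) have code: "code_at prog p [JumpPosI i (p + csize d + 2)]"
      "code_at prog (p + 1) (compile (p + 1) d)"
      "code_at prog (p + csize d + 1) [JumpI (p + csize d + 2 + csize c)]"
      "code_at prog (p + csize d + 2) (compile (p + csize d + 2) c)"
    by (auto simp: code_at_append code_at_Cons[where cs = "_ @ _"] code_at_Cons[where cs = "compile _ _"])
  have jump: "reaches prog B (p, s) 1 (if fst s i > 0 then p + csize d + 2 else p + 1, s)"
    using reaches_instr[OF code(1) *(3)] by (auto simp: s)
  show "\<exists>s'. reaches prog B (p, s) (steps N (Cond i c d)) (p + csize (Cond i c d), s') \<and> Q s' \<and> bounded B s'"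
  proof (cases "fst s i > 0")
    case True
    obtain s' where s': "reaches prog B (p + csize d + 2, s) (steps N c) (p + csize d + 2 + csize c, s')"
        "Q s'" "bounded B s'"
      using c code(4) * True unfolding ht_def by blast
    have "reaches prog B (p, s) 1 (p + csize d + 2, s)"
      using jump True by simp
    from reaches_mono[OF reaches_trans[OF this s'(1)], of "steps N (Cond i c d)"]
    have "reaches prog B (p, s) (steps N (Cond i c d)) (p + csize (Cond i c d), s')"
      by (simp add: add_ac)
    then show ?thesis using s' by blast
  next
    case False
    obtain s' where s': "reaches prog B (p + 1, s) (steps N d) (p + 1 + csize d, s')"
        "Q s'" "bounded B s'"
      using d code(2) * False unfolding ht_def by blast
    have 1: "reaches prog B (p, s) 1 (p + 1, s)"
      using jump False by simp
    have 2: "reaches prog B (p + 1 + csize d, s') 1 (p + csize d + 2 + csize c, s')"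
      using reaches_instr[OF code(3) s'(3)] by (cases s') (simp add: add_ac)
    from reaches_mono[OF reaches_trans[OF reaches_trans[OF 1 s'(1)] 2], of "steps N (Cond i c d)"]
    have "reaches prog B (p, s) (steps N (Cond i c d)) (p + csize (Cond i c d), s')"
      by (simp add: add_ac)
    then show ?thesis using s' by blast
  qed
qed

text \<open>The number of iterations is fixed beforehand and the invariant ties the guard to
  \<open>j < n\<close>, which replaces a termination measure.\<close>

lemma ht_Loop:
  assumes body: "\<And>j. j < n \<Longrightarrow> ht N B (I j) c (I (Suc j))"
    and guard: "\<And>j s. I j s \<Longrightarrow> fst s i > 0 \<longleftrightarrow> j < n"
    and n: "n \<le> N"
  shows "ht N B (I 0) (Loop i c) (I n)"
  unfolding ht_def
proof (intro allI impI, elim conjE)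
  fix prog p s assume *: "code_at prog p (compile p (Loop i c))" "I 0 s" "bounded B s"
  from *(1) have code: "code_at prog p [JumpPosI i (p + 2)]"
      "code_at prog (p + 1) [JumpI (p + csize c + 3)]"
      "code_at prog (p + 2) (compile (p + 2) c)"
      "code_at prog (p + csize c + 2) [JumpI p]"
    by (auto simp: code_at_append code_at_Cons[where cs = "_ @ _"] code_at_Cons[where cs = "_ # _"]
        numeral_2_eq_2)
  have jump: "reaches prog B (p, s) 1 (if fst s i > 0 then p + 2 else p + 1, s)" if "bounded B s" for s
    using reaches_instr[OF code(1) that] by (cases s) auto
  have iter: "\<exists>s'. reaches prog B (p, s) (j * (steps N c + 2)) (p, s') \<and> I j s' \<and> bounded B s'"
    if "j \<le> n" for j
    using that
  proof (induction j)
    case 0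
    then show ?case using * reaches_refl[of prog B "(p, s)"] by (intro exI[of _ s]) simp
  next
    case (Suc j)
    then obtain s1 where 1: "reaches prog B (p, s) (j * (steps N c + 2)) (p, s1)" "I j s1" "bounded B s1"
      by auto
    have 2: "reaches prog B (p, s1) 1 (p + 2, s1)"
      using jump[OF 1(3)] guard[OF 1(2)] Suc by simp
    obtain s2 where 3: "reaches prog B (p + 2, s1) (steps N c) (p + 2 + csize c, s2)"
        "I (Suc j) s2" "bounded B s2"
      using body[of j] Suc code(3) 1 unfolding ht_def by (metis Suc_le_lessD)
    have 4: "reaches prog B (p + 2 + csize c, s2) 1 (p, s2)"
      using reaches_instr[OF code(4) 3(3)] by (cases s2) (simp add: add_ac)
    show ?case
      using reaches_trans[OF 1(1) reaches_trans[OF reaches_trans[OF 2 3(1)] 4]] 3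
      by (intro exI[of _ s2]) (simp add: algebra_simps)
  qed
  obtain s1 where 1: "reaches prog B (p, s) (n * (steps N c + 2)) (p, s1)" "I n s1" "bounded B s1"
    using iter by blast
  have 2: "reaches prog B (p, s1) 1 (p + 1, s1)"
    using jump[OF 1(3)] guard[OF 1(2)] by simp
  have 3: "reaches prog B (p + 1, s1) 1 (p + csize c + 3, s1)"
    using reaches_instr[OF code(2) 1(3)] by (cases s1) simp
  have "n * (steps N c + 2) + (1 + 1) \<le> steps N (Loop i c)"
    using mult_le_mono1[OF n, of "steps N c + 2"] by (simp only: steps.simps one_add_one add_le_cancel_right)
  then have "reaches prog B (p, s) (steps N (Loop i c)) (p + csize (Loop i c), s1)"
    using reaches_mono[OF reaches_trans[OF 1(1) reaches_trans[OF 2 3]]] by (simp add: add_ac)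
  then show "\<exists>s'. reaches prog B (p, s) (steps N (Loop i c)) (p + csize (Loop i c), s') \<and> I n s' \<and> bounded B s'"
    using 1 by blast
qed

section \<open>Verification conditions for loop-free code\<close>

fun wp_instr :: "int \<Rightarrow> instr \<Rightarrow> (state \<Rightarrow> bool) \<Rightarrow> state \<Rightarrow> bool" where
  "wp_instr B (SetI i k) Q (X, inp, out) \<longleftrightarrow> \<bar>k\<bar> \<le> B \<and> Q (X(i := k), inp, out)"
| "wp_instr B (AddI i j k) Q (X, inp, out) \<longleftrightarrow> \<bar>X j + X k\<bar> \<le> B \<and> Q (X(i := X j + X k), inp, out)"
| "wp_instr B (SubI i j k) Q (X, inp, out) \<longleftrightarrow> \<bar>X j - X k\<bar> \<le> B \<and> Q (X(i := X j - X k), inp, out)"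
| "wp_instr B (MulI i j k) Q (X, inp, out) \<longleftrightarrow> \<bar>X j * X k\<bar> \<le> B \<and> Q (X(i := X j * X k), inp, out)"
| "wp_instr B (LoadI i j) Q (X, inp, out) \<longleftrightarrow> Q (X(i := X (X j)), inp, out)"
| "wp_instr B (StoreI i j) Q (X, inp, out) \<longleftrightarrow> Q (X(X i := X j), inp, out)"
| "wp_instr B (JumpI m) Q (X, inp, out) \<longleftrightarrow> False"
| "wp_instr B (JumpPosI i m) Q (X, inp, out) \<longleftrightarrow> False"
| "wp_instr B (ReadI i) Q (X, inp, out) \<longleftrightarrow> Q (X(i := next_input inp), tl inp, out)"
| "wp_instr B (WriteI i) Q (X, inp, out) \<longleftrightarrow> Q (X, inp, out @ [X i])"

text \<open>Loops get the condition \<open>False\<close> because they are handled by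
  \<open>ht_Loop\<close>; this function evaluates only the code between them.\<close>

fun wp :: "int \<Rightarrow> com \<Rightarrow> (state \<Rightarrow> bool) \<Rightarrow> state \<Rightarrow> bool" where
  "wp B Skip Q s \<longleftrightarrow> Q s"
| "wp B (Do ins) Q s \<longleftrightarrow> wp_instr B ins Q s"
| "wp B (c ;; d) Q s \<longleftrightarrow> wp B c (wp B d Q) s"
| "wp B (Cond i c d) Q s \<longleftrightarrow> (if fst s i > 0 then wp B c Q s else wp B d Q s)"
| "wp B (Loop i c) Q s \<longleftrightarrow> False"

text \<open>Every triple preserves \<open>bounded B\<close>. Hence only constants and arithmetic
  results need a size condition; copied values already satisfy it.\<close>

lemma ht_wp: "ht N B (wp B c Q) c Q"
proof (induction c arbitrary: Q)
  case Skip
  show ?case using ht_Skip[of N B Q] by (rule ht_conseq) auto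
next
  case (Do ins)
  show ?case unfolding ht_def
  proof (intro allI impI, elim conjE)
    fix prog p s
    assume *: "code_at prog p (compile p (Do ins))" "wp B (Do ins) Q s" "bounded B s"
    obtain X inp out where s: "s = (X, inp, out)" by (cases s)
    obtain s' where s': "instr_exec ins (p, s) = (p + 1, s')" "Q s'"
      using *(2) by (cases ins) (auto simp: s)
    have "reaches prog B (p, s) 1 (p + 1, s')"
      using reaches_instr[of prog p ins B s] * s'(1) by (cases ins) (auto simp: s)
    moreover have "bounded B s'"
      using s'(1) *(2,3) by (cases ins) (auto simp: s next_input_def dest: list.set_sel(2) split: list.splits)
    ultimately show "\<exists>s'. reaches prog B (p, s) (steps N (Do ins)) (p + csize (Do ins), s') \<and>
        Q s' \<and> bounded B s'"
      using s'(2) by (intro exI[of _ s']) simp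
  qed
next
  case (Seq c d)
  show ?case
    by (rule ht_conseq[OF ht_Seq[OF Seq.IH(1) Seq.IH(2)]]) auto
next
  case (Cond i c d)
  show ?case
    by (rule ht_Cond; rule ht_conseq[OF Cond.IH(1)] ht_conseq[OF Cond.IH(2)]) auto
next
  case (Loop i c)
  show ?case by (simp add: ht_def)
qed

lemma ht_wpI:
  assumes "\<And>X inp out. P (X, inp, out) \<Longrightarrow> bounded B (X, inp, out) \<Longrightarrow> wp B c Q (X, inp, out)"
  shows "ht N B P c Q"
  using ht_wp[of N B c Q] assms unfolding ht_def by (metis prod_cases3)


section \<open>Counting loops and arrays held in registers\<close>

fun block :: "instr list \<Rightarrow> com" where
  "block [] = Skip"
| "block (ins # is) = Do ins ;; block is"

text \<open>
  Scalars live in registers with negative index, so that the registers with nonnegative index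
  form an array. \<open>rZero\<close> is never written and \<open>rOne\<close> holds 1.
\<close>

abbreviation "rZero \<equiv> -1 :: int"
abbreviation "rOne \<equiv> -2 :: int"
abbreviation "rN \<equiv> -3 :: int"
abbreviation "rD \<equiv> -4 :: int"
abbreviation "rM \<equiv> -5 :: int"
abbreviation "rA \<equiv> -6 :: int"
abbreviation "rPB \<equiv> -7 :: int"
abbreviation "rPE \<equiv> -8 :: int"
abbreviation "rI \<equiv> -9 :: int"
abbreviation "rT \<equiv> -10 :: int"
abbreviation "rJ \<equiv> -11 :: int"
abbreviation "rU \<equiv> -12 :: int"
abbreviation "rSum \<equiv> -13 :: int"
abbreviation "rFlag \<equiv> -14 :: int"
abbreviation "rW \<equiv> -15 :: int"
abbreviation "rVal \<equiv> -16 :: int"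
abbreviation "rBest \<equiv> -17 :: int"
abbreviation "rBestW \<equiv> -18 :: int"
abbreviation "rP \<equiv> -19 :: int"
abbreviation "rQ \<equiv> -20 :: int"
abbreviation "rR \<equiv> -21 :: int"
abbreviation "rV \<equiv> -22 :: int"
abbreviation "rG \<equiv> -23 :: int"
abbreviation "rY \<equiv> -24 :: int"
abbreviation "rX \<equiv> -25 :: int"

text \<open>Since only positivity can be tested, \<open>t\<close> holds the number of remaining
  iterations. It is recomputed after each pass, so the body may overwrite it.\<close>

definition For :: "int \<Rightarrow> int \<Rightarrow> int \<Rightarrow> com \<Rightarrow> com" where
  "For i l t c = block [SetI i 0, SubI t l i] ;; Loop t (c ;; block [AddI i i rOne, SubI t l i])"

text \<open>\<open>stable\<close> makes the invariant independent of the counter and of the test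
  register, so the loop may update both. The value of the counter is passed to the body separately,
  and the body has to leave it in place.\<close>

lemma ht_For:
  assumes body: "\<And>j. j < n \<Longrightarrow>
      ht N B (\<lambda>s. I j s \<and> fst s i = int j) c (\<lambda>s. I (Suc j) s \<and> fst s i = int j)"
    and inv: "\<And>j X inp out. I j (X, inp, out) \<Longrightarrow> X l = int n \<and> X rOne = 1"
    and stable: "\<And>j X inp out v. I j (X, inp, out) \<Longrightarrow>
      I j (X(i := v), inp, out) \<and> I j (X(t := v), inp, out)"
    and distinct: "i \<noteq> t" "i \<noteq> l" "t \<noteq> l" "i \<noteq> rOne" "t \<noteq> rOne"
    and n: "n \<le> N" "int n \<le> B"
  shows "ht N B (I 0) (For i l t c) (I n)"
proof -
  define J where "J j s \<longleftrightarrow> j \<le> n \<and> I j s \<and> fst s i = int j \<and> fst s t = int n - int j" for j s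
  have "ht N B (I 0) (block [SetI i 0, SubI t l i]) (J 0)"
    by (rule ht_wpI) (use inv stable distinct n in \<open>force simp: J_def\<close>)
  moreover have "ht N B (J 0) (Loop t (c ;; block [AddI i i rOne, SubI t l i])) (J n)"
  proof (rule ht_Loop)
    fix j assume j: "j < n"
    have "ht N B (J j) c (\<lambda>s. I (Suc j) s \<and> fst s i = int j)"
      by (rule ht_conseq[OF body[OF j]]) (auto simp: J_def)
    moreover have "ht N B (\<lambda>s. I (Suc j) s \<and> fst s i = int j)
        (block [AddI i i rOne, SubI t l i]) (J (Suc j))"
    proof (rule ht_wpI)
      fix X inp out assume a: "I (Suc j) (X, inp, out) \<and> fst (X, inp, out) i = int j"
      note b = inv[OF conjunct1[OF a]]
      have "I (Suc j) (X(i := v, t := v'), inp, out)" for v v'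
        using stable a by blast
      then show "wp B (block [AddI i i rOne, SubI t l i]) (J (Suc j)) (X, inp, out)"
        using a b j n distinct by (simp add: J_def)
    qed
    ultimately show "ht N B (J j) (c ;; block [AddI i i rOne, SubI t l i]) (J (Suc j))"
      by (rule ht_Seq)
  qed (use n in \<open>auto simp: J_def\<close>)
  ultimately have "ht N B (I 0) (For i l t c) (J n)"
    unfolding For_def by (rule ht_Seq)
  then show ?thesis by (rule ht_conseq) (auto simp: J_def)
qed

definition arr :: "(int \<Rightarrow> int) \<Rightarrow> (nat \<Rightarrow> int) \<Rightarrow> nat \<Rightarrow> bool" where
  "arr X f m \<longleftrightarrow> (\<forall>k<m. X (int k) = f k)"

lemma arr_upd_neg [simp]: "a < 0 \<Longrightarrow> arr (X(a := v)) f m \<longleftrightarrow> arr X f m"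
  by (simp add: arr_def)

lemma arrD: "arr X f m \<Longrightarrow> k < m \<Longrightarrow> X (int k) = f k"
  by (simp add: arr_def)

section \<open>Reading the input over a common denominator\<close>

definition flat :: "(int \<times> int) list \<Rightarrow> int list" where
  "flat fs = concat (map (\<lambda>(a, d). [a, d]) fs)"

definition den :: "(int \<times> int) list \<Rightarrow> nat \<Rightarrow> int" where
  "den fs k = (\<Prod>l<k. snd (fs ! l))"

text \<open>The first \<open>k\<close> fractions are \<open>num fs k j / den fs k\<close> for \<open>j < k\<close>.\<close>

definition num :: "(int \<times> int) list \<Rightarrow> nat \<Rightarrow> nat \<Rightarrow> int" where
  "num fs k j = (\<Prod>l<k. if l = j then fst (fs ! l) else snd (fs ! l))"

lemma den_Suc: "den fs (Suc k) = den fs k * snd (fs ! k)"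
  by (simp add: den_def)

lemma num_Suc: "j \<noteq> k \<Longrightarrow> num fs (Suc k) j = num fs k j * snd (fs ! k)"
  by (simp add: num_def)

lemma num_Suc_same: "num fs (Suc k) k = fst (fs ! k) * den fs k"
  by (simp add: num_def den_def mult.commute)

text \<open>A new fraction \<open>a / d\<close> multiplies all earlier numerators by
  \<open>d\<close> and enters as \<open>a\<close> times the old denominator. Thus every stored
  number is a \<open>num\<close> or \<open>den\<close> of some prefix of the input.\<close>

definition read_fraction :: com where
  "read_fraction =
     block [ReadI rP, ReadI rQ] ;;
     For rJ rI rU (block [LoadI rV rJ, MulI rV rV rQ, StoreI rJ rV]) ;;
     block [MulI rP rP rD, StoreI rI rP, MulI rD rD rQ]"

text \<open>\<open>rM\<close> becomes \<open>4 * n + 1\<close>, counting four vectors and the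
  coefficient of \<open>w\<close>; \<open>rD\<close> starts as the empty product.\<close>

definition read_instance :: com where
  "read_instance =
     block [ReadI rN, SetI rOne 1, SetI rD 1, SetI rM 4, MulI rM rM rN, AddI rM rM rOne] ;;
     For rI rM rT read_fraction"

lemma ht_read_instance:
  assumes len: "length fs = 4 * n + 1"
    and B: "int (4 * n + 1) \<le> B" "4 \<le> B" "4 * n + 1 \<le> N"
    and num: "\<And>k j. k \<le> 4 * n + 1 \<Longrightarrow> \<bar>num fs k j\<bar> \<le> B"
    and den: "\<And>k. k \<le> 4 * n + 1 \<Longrightarrow> \<bar>den fs k\<bar> \<le> B"
  shows "ht N B (\<lambda>(X, inp, out). X = (\<lambda>_. 0) \<and> inp = int n # flat fs \<and> out = []) read_instance
     (\<lambda>(X, inp, out). X rN = int n \<and> X rOne = 1 \<and> X rZero = 0 \<and> X rFlag = 0 \<and> X rSum = 0 \<and>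
        X rD = den fs (4 * n + 1) \<and> arr X (num fs (4 * n + 1)) (4 * n + 1) \<and> out = [])"
proof -
  define m where "m = 4 * n + 1"
  have lenm: "length fs = m" and Bm: "int m \<le> B" "m \<le> N" using len B by (auto simp: m_def)
  \<comment> \<open>\<open>rFlag\<close> and \<open>rSum\<close> are tracked because
    \<open>prepare\<close> accumulates in them and relies on their initial value 0.\<close>
  define env where "env X \<longleftrightarrow> X rN = int n \<and> X rOne = 1 \<and> X rZero = 0 \<and> X rFlag = 0 \<and>
    X rSum = 0 \<and> X rM = int m" for X :: "int \<Rightarrow> int"
  define I where "I k = (\<lambda>(X, inp, out). env X \<and> X rD = den fs k \<and> arr X (num fs k) k \<and>
    inp = flat (drop k fs) \<and> out = ([] :: int list))" for k
  have "ht N B (\<lambda>(X, inp, out). X = (\<lambda>_. 0) \<and> inp = int n # flat fs \<and> out = [])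
      (block [ReadI rN, SetI rOne 1, SetI rD 1, SetI rM 4, MulI rM rM rN, AddI rM rM rOne]) (I 0)"
    by (rule ht_wpI) (use B in \<open>auto simp: I_def env_def m_def next_input_def arr_def den_def\<close>)
  moreover have "ht N B (I 0) (For rI rM rT read_fraction) (I m)"
  proof (rule ht_For)
    fix k assume k: "k < m"
    define a d where "a = fst (fs ! k)" and "d = snd (fs ! k)"
    \<comment> \<open>In the middle of rescaling, entries below \<open>j\<close> already belong to
      the prefix of length \<open>Suc k\<close>, the others still to that of length
      \<open>k\<close>.\<close>
    define J where "J j = (\<lambda>(X, inp, out). env X \<and> X rD = den fs k \<and> X rI = int k \<and> X rP = a \<and>
      X rQ = d \<and> arr X (\<lambda>i. if i < j then num fs (Suc k) i else num fs k i) k \<and>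
      inp = flat (drop (Suc k) fs) \<and> out = ([] :: int list))" for j
    have drop: "flat (drop k fs) = a # d # flat (drop (Suc k) fs)"
      using k by (simp add: flat_def a_def d_def lenm Cons_nth_drop_Suc[symmetric] split_beta)
    have "ht N B (\<lambda>s. I k s \<and> fst s rI = int k) (block [ReadI rP, ReadI rQ]) (J 0)"
      by (rule ht_wpI) (auto simp: I_def J_def env_def drop next_input_def)
    moreover have "ht N B (J 0) (For rJ rI rU (block [LoadI rV rJ, MulI rV rV rQ, StoreI rJ rV])) (J k)"
    proof (rule ht_For)
      fix j assume j: "j < k"
      have step: "num fs k j * d = num fs (Suc k) j" using j by (simp add: num_Suc d_def)
      have bound: "\<bar>num fs k j * d\<bar> \<le> B" unfolding step using k num[of "Suc k" j] by (simp add: m_def)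
      show "ht N B (\<lambda>s. J j s \<and> fst s rJ = int j) (block [LoadI rV rJ, MulI rV rV rQ, StoreI rJ rV])
        (\<lambda>s. J (Suc j) s \<and> fst s rJ = int j)"
      proof (rule ht_wpI)
        fix X inp out assume *: "J j (X, inp, out) \<and> fst (X, inp, out) rJ = int j"
        then have "X (int j) = num fs k j"
          using j by (auto simp: J_def arr_def)
        then show "wp B (block [LoadI rV rJ, MulI rV rV rQ, StoreI rJ rV])
            (\<lambda>s. J (Suc j) s \<and> fst s rJ = int j) (X, inp, out)"
          using * bound by (auto simp: J_def env_def arr_def step less_Suc_eq)
      qed
    qed (use k Bm in \<open>auto simp: J_def env_def\<close>)
    moreover have "ht N B (J k) (block [MulI rP rP rD, StoreI rI rP, MulI rD rD rQ])
        (\<lambda>s. I (Suc k) s \<and> fst s rI = int k)"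
    proof (rule ht_wpI)
      fix X inp out assume *: "J k (X, inp, out)"
      have P: "a * den fs k = num fs (Suc k) k" and D: "den fs k * d = den fs (Suc k)"
        by (simp_all add: num_Suc_same den_Suc a_def d_def)
      have "\<bar>a * den fs k\<bar> \<le> B" "\<bar>den fs k * d\<bar> \<le> B"
        unfolding P D using k num[of "Suc k" k] den[of "Suc k"] by (simp_all add: m_def)
      then show "wp B (block [MulI rP rP rD, StoreI rI rP, MulI rD rD rQ])
          (\<lambda>s. I (Suc k) s \<and> fst s rI = int k) (X, inp, out)"
        using * by (auto simp: J_def I_def env_def arr_def P D less_Suc_eq)
    qed
    ultimately show "ht N B (\<lambda>s. I k s \<and> fst s rI = int k) read_fraction
        (\<lambda>s. I (Suc k) s \<and> fst s rI = int k)"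
      unfolding read_fraction_def by (intro ht_Seq)
  qed (use Bm in \<open>auto simp: I_def env_def\<close>)
  ultimately have "ht N B (\<lambda>(X, inp, out). X = (\<lambda>_. 0) \<and> inp = int n # flat fs \<and> out = [])
      read_instance (I m)"
    unfolding read_instance_def by (rule ht_Seq)
  then show ?thesis by (rule ht_conseq) (auto simp: I_def env_def m_def)
qed

section \<open>Solving the scaled problem\<close>

lemma abs_mult_le: "\<bar>x\<bar> \<le> a \<Longrightarrow> \<bar>y\<bar> \<le> b \<Longrightarrow> \<bar>x * y\<bar> \<le> a * b" for x y a b :: int
  by (simp add: abs_mult mult_mono')

section \<open>The program for the scaled problem\<close>

definition prep_item :: com where
  "prep_item =
     block [LoadI rV rI, AddI rP rN rI, LoadI rQ rP, SubI rV rV rQ, StoreI rP rV,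
       AddI rP rPB rI, LoadI rV rP, AddI rSum rSum rV, SubI rV rZero rV] ;;
     Cond rV (Do (SetI rFlag 1)) Skip"

text \<open>The unboundedness criteria become positivity tests of \<open>- b i\<close>, of
  \<open>- A\<close> and of \<open>A\<close> minus the sum of the \<open>b i\<close>, collected in
  \<open>rFlag\<close>.\<close>

definition prepare :: com where
  "prepare =
     block [AddI rPB rN rN, LoadI rA rPB, AddI rPB rPB rOne, AddI rPE rPB rN] ;;
     For rI rN rT prep_item ;;
     block [SubI rV rZero rA] ;; Cond rV (Do (SetI rFlag 1)) Skip ;;
     block [SubI rV rA rSum] ;; Cond rV (Do (SetI rFlag 1)) Skip"

definition choose_item :: com where
  "choose_item =
     block [LoadI rP rJ, SubI rP rP rW] ;; Cond rP Skip (Do (SetI rP 0)) ;;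
     block [AddI rQ rN rJ, LoadI rQ rQ, SubI rQ rQ rW] ;; Cond rQ Skip (Do (SetI rQ 0)) ;;
     block [AddI rV rPB rJ, LoadI rV rV, AddI rR rPE rJ, LoadI rR rR, MulI rR rR rD,
       MulI rG rV rP, MulI rV rV rQ, AddI rV rR rV, SubI rR rG rV] ;;
     Cond rR (block [AddI rG rV rZero, AddI rY rQ rZero, SetI rX 1])
       (block [AddI rY rP rZero, SetI rX 0])"

definition update_best :: com where
  "update_best = block [AddI rBest rVal rZero, AddI rBestW rW rZero]"

text \<open>Index 0 marks the first candidate, which initialises the best value without a
  comparison; this avoids a sentinel for infinity.\<close>

definition try_candidate :: com where
  "try_candidate =
     block [LoadI rW rI, MulI rVal rA rW] ;;
     For rJ rN rU (choose_item ;; Do (AddI rVal rVal rG)) ;;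
     Cond rI (Do (SubI rV rBest rVal) ;; Cond rV update_best Skip) update_best"

text \<open>Only the best \<open>w\<close> survives the search, so \<open>y\<close> and
  \<open>x\<close> are recomputed from it, in two passes because the answer code lists all of
  \<open>y\<close> before \<open>x\<close>.\<close>

definition write_optimum :: com where
  "write_optimum =
     block [AddI rW rBestW rZero, WriteI rOne, WriteI rW, WriteI rD] ;;
     For rJ rN rU (choose_item ;; block [WriteI rY, WriteI rD]) ;;
     For rJ rN rU (choose_item ;; block [WriteI rX, WriteI rOne])"

text \<open>\<open>rPB\<close> doubles as the loop limit: the address \<open>2 * n + 1\<close> of
  the first \<open>b i\<close> is also the number of candidates stored below it.\<close>

definition optimize :: com where
  "optimize = Cond rFlag (Do (WriteI rZero)) (For rI rPB rT try_candidate ;; write_optimum)"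

text \<open>
  The numbers \<open>Z k / D\<close> are the input data \<open>q\<close>, \<open>c\<close>, \<open>a\<close>, \<open>b\<close>, \<open>e\<close> in this order, where
  \<open>a\<close>, \<open>b\<close>, \<open>e\<close> are the objective coefficients of \<open>w\<close>, \<open>y\<close>, \<open>x\<close>. With \<open>r i = q i - c i\<close>, fixing \<open>x i\<close> to 0 or 1
  leaves the constraint \<open>w + y i \<ge> q i\<close> or \<open>w + y i \<ge> r i\<close>.
\<close>

locale scaled_data =
  fixes n N :: nat and Z :: "nat \<Rightarrow> int" and D M B :: int
  assumes Z_le: "\<And>k. k < 4 * n + 1 \<Longrightarrow> \<bar>Z k\<bar> \<le> M"
    and D_pos: "0 < D" and D_le: "D \<le> M" and M_ge_1: "1 \<le> M"
    and n_le: "int (4 * n + 1) \<le> M" and N_ge: "4 * n + 1 \<le> N" and B_ge: "32 * M ^ 3 \<le> B"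
begin

definition q where "q i = Z i"
definition r where "r i = Z i - Z (n + i)"
definition A where "A = Z (2 * n)"
definition b where "b i = Z (2 * n + 1 + i)"
definition e where "e i = Z (3 * n + 1 + i)"

text \<open>
  The array after \<open>j\<close> of the numbers \<open>c i\<close> have been overwritten with \<open>r i\<close>. In the end the
  candidates for \<open>w\<close> occupy a contiguous segment; the entry \<open>A\<close> at address \<open>2 * n\<close> is included
  as a harmless additional candidate, which makes the search nonempty for \<open>n = 0\<close>.
\<close>

definition prepared :: "nat \<Rightarrow> nat \<Rightarrow> int" where
  "prepared j k = (if n \<le> k \<and> k < n + j then r (k - n) else Z k)"

definition y0 where "y0 w i = max 0 (q i - w)"
definition y1 where "y1 w i = max 0 (r i - w)"
definition cost0 where "cost0 w i = b i * y0 w i"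
text \<open>Costs are scaled by the square of \<open>D\<close>: both factors of
  \<open>b i * y1 w i\<close> carry one \<open>D\<close>, so the lone coefficient \<open>e i\<close>
  receives a second.\<close>

definition cost1 where "cost1 w i = e i * D + b i * y1 w i"
definition pick where "pick w i \<longleftrightarrow> cost1 w i < cost0 w i"
definition y_opt where "y_opt w i = (if pick w i then y1 w i else y0 w i)"
definition x_opt :: "int \<Rightarrow> nat \<Rightarrow> int" where "x_opt w i = (if pick w i then 1 else 0)"
definition item where "item w i = min (cost0 w i) (cost1 w i)"
definition total where "total w j = A * w + (\<Sum>i<j. item w i)"

definition base :: "(int \<Rightarrow> int) \<Rightarrow> bool" where
  "base X \<longleftrightarrow> X rN = int n \<and> X rOne = 1 \<and> X rZero = 0 \<and> X rD = D"

definition ready :: "(int \<Rightarrow> int) \<Rightarrow> bool" where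
  "ready X \<longleftrightarrow> base X \<and> X rA = A \<and> X rPB = 2 * int n + 1 \<and> X rPE = 3 * int n + 1"

section \<open>Size bounds for the scaled data\<close>

lemma M_powers: "M \<le> M ^ 2" "M ^ 2 \<le> M ^ 3" "1 \<le> M ^ 3"
proof -
  show "M \<le> M ^ 2" "M ^ 2 \<le> M ^ 3"
    using M_ge_1 by (simp_all add: power2_eq_square power3_eq_cube)
  show "1 \<le> M ^ 3" using M_ge_1 by simp
qed

lemma linear_le_B: "32 * M \<le> B" "32 * M ^ 2 \<le> B" "32 \<le> B"
  using M_powers B_ge M_ge_1 by linarith+

lemma const_le_B: "0 \<le> B" "1 \<le> B" "0 < B"
  using linear_le_B by linarith+

lemma n_bounds: "int n \<le> M" "4 * int n + 1 \<le> M" "n \<le> N" "2 * n + 1 \<le> N" "2 * int n + 1 \<le> B" "int n \<le> B"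
  using n_le N_ge linear_le_B by linarith+

lemma coeff_le:
  "i < n \<Longrightarrow> \<bar>q i\<bar> \<le> M" "i < n \<Longrightarrow> \<bar>r i\<bar> \<le> 2 * M" "\<bar>A\<bar> \<le> M"
  "i < n \<Longrightarrow> \<bar>b i\<bar> \<le> M" "i < n \<Longrightarrow> \<bar>e i\<bar> \<le> M"
  using Z_le[of i] Z_le[of "n + i"] Z_le[of "2 * n"] Z_le[of "2 * n + 1 + i"] Z_le[of "3 * n + 1 + i"]
  by (auto simp: q_def r_def A_def b_def e_def)

lemma prepared_addr:
  "arr X (prepared n) (4 * n + 1) \<Longrightarrow> i < n \<Longrightarrow> X (int i) = q i"
  "arr X (prepared n) (4 * n + 1) \<Longrightarrow> i < n \<Longrightarrow> X (int n + int i) = r i"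
  "arr X (prepared n) (4 * n + 1) \<Longrightarrow> X (2 * int n) = A"
  "arr X (prepared n) (4 * n + 1) \<Longrightarrow> i < n \<Longrightarrow> X (2 * int n + 1 + int i) = b i"
  "arr X (prepared n) (4 * n + 1) \<Longrightarrow> i < n \<Longrightarrow> X (3 * int n + 1 + int i) = e i"
  using arrD[of X "prepared n" "4 * n + 1" i] arrD[of X "prepared n" "4 * n + 1" "n + i"]
    arrD[of X "prepared n" "4 * n + 1" "2 * n"] arrD[of X "prepared n" "4 * n + 1" "2 * n + 1 + i"]
    arrD[of X "prepared n" "4 * n + 1" "3 * n + 1 + i"]
  by (auto simp: prepared_def q_def r_def A_def b_def e_def add_ac)

lemma sum_b_le: "j \<le> n \<Longrightarrow> \<bar>\<Sum>i<j. b i\<bar> \<le> M ^ 2"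
proof -
  assume j: "j \<le> n"
  have "\<bar>\<Sum>i<j. b i\<bar> \<le> (\<Sum>i<j. M)"
    using j by (intro order.trans[OF sum_abs sum_mono]) (auto intro: coeff_le)
  also have "\<dots> \<le> M * M"
    using j n_bounds M_ge_1 by (simp add: mult_right_mono)
  finally show ?thesis by (simp add: power2_eq_square)
qed

lemma ht_prepare:
  "ht N B (\<lambda>(X, inp, out). base X \<and> X rFlag = 0 \<and> X rSum = 0 \<and> arr X Z (4 * n + 1) \<and> out = [])
     prepare
   (\<lambda>(X, inp, out). ready X \<and> (X rFlag > 0 \<longleftrightarrow> A < 0 \<or> (\<exists>i<n. b i < 0) \<or> A > (\<Sum>i<n. b i)) \<and>
     arr X (prepared n) (4 * n + 1) \<and> out = [])"
proof -
  define I where "I j = (\<lambda>(X, inp :: int list, out). ready X \<and> (X rFlag > 0 \<longleftrightarrow> (\<exists>i<j. b i < 0)) \<and>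
     X rSum = (\<Sum>i<j. b i) \<and> arr X (prepared j) (4 * n + 1) \<and> out = ([] :: int list))" for j
  note bounds = n_bounds linear_le_B M_ge_1
  have "ht N B (\<lambda>(X, inp, out). base X \<and> X rFlag = 0 \<and> X rSum = 0 \<and> arr X Z (4 * n + 1) \<and> out = [])
     (block [AddI rPB rN rN, LoadI rA rPB, AddI rPB rPB rOne, AddI rPE rPB rN]) (I 0)"
  proof (rule ht_wpI)
    fix X :: "int \<Rightarrow> int" and inp out :: "int list"
    assume *: "case (X, inp, out) of (X, inp, out) \<Rightarrow>
      base X \<and> X rFlag = 0 \<and> X rSum = 0 \<and> arr X Z (4 * n + 1) \<and> out = []"
    then have "X (int n + int n) = A"
      using arrD[of X Z "4 * n + 1" "2 * n"] by (simp add: A_def)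
    moreover have "prepared 0 = Z" by (auto simp: prepared_def)
    moreover have "\<bar>int n + int n\<bar> \<le> B" "\<bar>int n + int n + 1\<bar> \<le> B" "\<bar>int n + int n + 1 + int n\<bar> \<le> B"
      using bounds by linarith+
    ultimately show "wp B (block [AddI rPB rN rN, LoadI rA rPB, AddI rPB rPB rOne, AddI rPE rPB rN])
        (I 0) (X, inp, out)"
      using * by (simp add: I_def ready_def base_def)
  qed
  moreover have "ht N B (I 0) (For rI rN rT prep_item) (I n)"
  proof (rule ht_For)
    fix j assume j: "j < n"
    show "ht N B (\<lambda>s. I j s \<and> fst s rI = int j) prep_item (\<lambda>s. I (Suc j) s \<and> fst s rI = int j)"
    proof (rule ht_wpI)
      fix X :: "int \<Rightarrow> int" and inp out :: "int list"
      assume *: "I j (X, inp, out) \<and> fst (X, inp, out) rI = int j"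
      then have arr: "arr X (prepared j) (4 * n + 1)" by (simp add: I_def)
      have addr: "X (int j) = q j" "X (int n + int j) = Z (n + j)" "X (2 * int n + 1 + int j) = b j"
        using arrD[OF arr, of j] arrD[OF arr, of "n + j"] arrD[OF arr, of "2 * n + 1 + j"] j
        by (auto simp: prepared_def q_def b_def add_ac)
      have val: "\<bar>int n + int j\<bar> \<le> B" "\<bar>2 * int n + 1 + int j\<bar> \<le> B"
        using j n_bounds(2) linear_le_B(1) M_ge_1 by linarith+
      have val2: "\<bar>q j - Z (n + j)\<bar> \<le> B"
        using coeff_le(2)[OF j] linear_le_B(1) M_ge_1 by (simp add: q_def r_def)
      have val3: "\<bar>b j\<bar> \<le> B"
        using coeff_le(4)[OF j] linear_le_B(1) M_ge_1 by linarith
      have val4: "\<bar>(\<Sum>i<j. b i) + b j\<bar> \<le> B"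
        using sum_b_le[of "Suc j"] j linear_le_B(2) by simp
      \<comment> \<open>This identifies the address used by \<open>StoreI\<close> with an array
        index, so that exactly one entry changes.\<close>
      have "int k = int n + int j \<longleftrightarrow> k = n + j" for k by linarith
      then have "arr (X(int n + int j := q j - Z (n + j))) (prepared (Suc j)) (4 * n + 1)"
        if "arr X (prepared j) (4 * n + 1)" for X
        using that j unfolding arr_def by (auto simp: prepared_def r_def q_def)
      then show "wp B prep_item (\<lambda>s. I (Suc j) s \<and> fst s rI = int j) (X, inp, out)"
        using * addr val val2 val3 val4 const_le_B
        by (auto simp: I_def ready_def base_def prep_item_def less_Suc_eq)
    qed
  qed (use n_bounds in \<open>auto simp: I_def ready_def base_def\<close>)
  moreover have "ht N B (I n)
     (block [SubI rV rZero rA] ;; Cond rV (Do (SetI rFlag 1)) Skip ;;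
      block [SubI rV rA rSum] ;; Cond rV (Do (SetI rFlag 1)) Skip)
     (\<lambda>(X, inp, out). ready X \<and> (X rFlag > 0 \<longleftrightarrow> A < 0 \<or> (\<exists>i<n. b i < 0) \<or> A > (\<Sum>i<n. b i)) \<and>
     arr X (prepared n) (4 * n + 1) \<and> out = [])"
  proof -
    have "\<bar>A - (\<Sum>i<n. b i)\<bar> \<le> B" "\<bar>A\<bar> \<le> B"
      using coeff_le(3) sum_b_le[of n] linear_le_B(1,2) M_ge_1 by simp_all
    then show ?thesis
      by (intro ht_wpI) (use const_le_B in \<open>auto simp: I_def ready_def base_def\<close>)
  qed
  ultimately show ?thesis
    unfolding prepare_def by (rule ht_Seq[OF _ ht_Seq])
qed

text \<open>Candidates may be differences \<open>r i\<close>, hence the range \<open>2 * M\<close>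
  for \<open>w\<close>. The least \<open>y\<close> is then at most \<open>4 * M\<close>; multiplying
  by \<open>b i\<close> and adding \<open>e i * D\<close> gives \<open>5 * M ^ 2\<close>.\<close>

lemma choose_bounds:
  assumes "i < n" "\<bar>w\<bar> \<le> 2 * M"
  shows "\<bar>q i - w\<bar> \<le> B" "\<bar>r i - w\<bar> \<le> B" "\<bar>e i * D\<bar> \<le> B" "\<bar>y0 w i\<bar> \<le> B" "\<bar>y1 w i\<bar> \<le> B"
    "\<bar>cost0 w i\<bar> \<le> 5 * M ^ 2" "\<bar>b i * y1 w i\<bar> \<le> B" "\<bar>cost1 w i\<bar> \<le> 5 * M ^ 2"
proof -
  note qw = coeff_le(1)[OF assms(1)] assms(2) and rw = coeff_le(2)[OF assms(1)] assms(2)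
  show 1: "\<bar>q i - w\<bar> \<le> B" using qw linear_le_B(1) M_ge_1 by linarith
  show 2: "\<bar>r i - w\<bar> \<le> B" using rw linear_le_B(1) M_ge_1 by linarith
  have y0: "\<bar>y0 w i\<bar> \<le> 4 * M" using qw M_ge_1 unfolding y0_def by linarith
  have y1: "\<bar>y1 w i\<bar> \<le> 4 * M" using rw unfolding y1_def by linarith
  show "\<bar>y0 w i\<bar> \<le> B" using y0 linear_le_B(1) M_ge_1 by linarith
  show "\<bar>y1 w i\<bar> \<le> B" using y1 linear_le_B(1) M_ge_1 by linarith
  have eD: "\<bar>e i * D\<bar> \<le> M ^ 2"
    using abs_mult_le[OF coeff_le(5)[OF assms(1)], of D M] D_pos D_le by (simp add: power2_eq_square)
  have by0: "\<bar>b i * y0 w i\<bar> \<le> 4 * M ^ 2"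
    using abs_mult_le[OF coeff_le(4)[OF assms(1)] y0] by (simp add: power2_eq_square)
  have by1: "\<bar>b i * y1 w i\<bar> \<le> 4 * M ^ 2"
    using abs_mult_le[OF coeff_le(4)[OF assms(1)] y1] by (simp add: power2_eq_square)
  show "\<bar>e i * D\<bar> \<le> B" using eD linear_le_B(2) by linarith
  show "\<bar>b i * y1 w i\<bar> \<le> B" using by1 linear_le_B(2) by linarith
  show "\<bar>cost0 w i\<bar> \<le> 5 * M ^ 2" using by0 unfolding cost0_def by linarith
  show "\<bar>cost1 w i\<bar> \<le> 5 * M ^ 2" using eD by1 unfolding cost1_def by linarith
qed

text \<open>A summary of \<open>choose_item\<close> for the search loop and the two output loops:
  \<open>Q\<close> sees the three results and arbitrary contents of the four scratch
  registers.\<close>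

lemma wp_choose_item:
  assumes ready: "ready X" and arr: "arr X (prepared n) (4 * n + 1)"
    and i: "i < n" "X rJ = int i" and w: "X rW = w" "\<bar>w\<bar> \<le> 2 * M"
    and Q: "\<And>v1 v2 v3 v4. Q (X(rP := v1, rQ := v2, rR := v3, rV := v4, rG := item w i,
      rY := y_opt w i, rX := x_opt w i), inp, out)"
  shows "wp B choose_item Q (X, inp, out)"
proof -
  note addr = prepared_addr(1,2,4,5)[OF arr, of i]
  \<comment> \<open>\<open>Q\<close> restated for any state that agrees with \<open>X\<close>
    outside the seven work registers, so that the exact chain of updates is irrelevant.\<close>
  have Q': "Q (X', inp, out)" if "X' rG = item w i" "X' rY = y_opt w i" "X' rX = x_opt w i"
    "\<And>k. k \<notin> {rP, rQ, rR, rV, rG, rY, rX} \<Longrightarrow> X' k = X k" for X'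
  proof -
    have "X' = X(rP := X' rP, rQ := X' rQ, rR := X' rR, rV := X' rV, rG := item w i,
      rY := y_opt w i, rX := x_opt w i)"
      using that by (auto simp: fun_eq_iff)
    then show ?thesis using Q by metis
  qed
  have nums: "\<bar>int n + int i\<bar> \<le> B" "\<bar>2 * int n + 1 + int i\<bar> \<le> B" "\<bar>3 * int n + 1 + int i\<bar> \<le> B"
    "0 \<le> B" "1 \<le> B"
    using i(1) n_bounds(2) linear_le_B(1) M_ge_1 by linarith+
  have costs: "\<bar>cost0 w i - cost1 w i\<bar> \<le> B" "\<bar>cost1 w i\<bar> \<le> B" "\<bar>cost0 w i\<bar> \<le> B"
    using choose_bounds(6,8)[OF i(1) w(2)] linear_le_B(2) by linarith+
  have c: "b i * y0 w i = cost0 w i" "e i * D + b i * y1 w i = cost1 w i"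
    by (simp_all add: cost0_def cost1_def)
  define X1 where "X1 = X(rP := y0 w i)"
  define X2 where "X2 = X1(rQ := y1 w i)"
  define X3 where "X3 = X2(rG := cost0 w i, rV := cost1 w i, rR := cost0 w i - cost1 w i)"
  have 1: "wp B (block [LoadI rP rJ, SubI rP rP rW] ;; Cond rP Skip (Do (SetI rP 0))) P (X, inp, out)"
    if "P (X1, inp, out)" for P
  proof -
    have "y0 w i = (if w < q i then q i - w else 0)" by (auto simp: y0_def)
    then show ?thesis using that addr(1) i w(1) choose_bounds(1)[OF i(1) w(2)] nums(4)
      by (cases "w < q i") (simp_all add: X1_def)
  qed
  have 2: "wp B (block [AddI rQ rN rJ, LoadI rQ rQ, SubI rQ rQ rW] ;; Cond rQ Skip (Do (SetI rQ 0))) P (X1, inp, out)"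
    if "P (X2, inp, out)" for P
  proof -
    have "y1 w i = (if w < r i then r i - w else 0)" by (auto simp: y1_def)
    then show ?thesis
      using that addr(2) i w(1) choose_bounds(2)[OF i(1) w(2)] nums(1,4) ready
      by (cases "w < r i") (simp_all add: X1_def X2_def ready_def base_def)
  qed
  have 3: "wp B (block [AddI rV rPB rJ, LoadI rV rV, AddI rR rPE rJ, LoadI rR rR, MulI rR rR rD,
       MulI rG rV rP, MulI rV rV rQ, AddI rV rR rV, SubI rR rG rV]) P (X2, inp, out)"
    if "P (X3, inp, out)" for P
    using that addr(3,4) i choose_bounds(3,7)[OF i(1) w(2)] nums(2,3) costs ready
    by (simp add: X3_def X2_def X1_def ready_def base_def c)
  have 4: "wp B (Cond rR (block [AddI rG rV rZero, AddI rY rQ rZero, SetI rX 1])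
       (block [AddI rY rP rZero, SetI rX 0])) Q (X3, inp, out)"
  proof (cases "cost1 w i < cost0 w i")
    case True
    then show ?thesis
      using ready choose_bounds(5)[OF i(1) w(2)] costs nums(5)
      by (simp add: X3_def X2_def X1_def ready_def base_def)
        (rule Q'; simp add: item_def y_opt_def x_opt_def pick_def)
  next
    case False
    then show ?thesis
      using ready choose_bounds(4)[OF i(1) w(2)] costs nums(4)
      by (simp add: X3_def X2_def X1_def ready_def base_def)
        (rule Q'; simp add: item_def y_opt_def x_opt_def pick_def)
  qed
  show ?thesis
    unfolding choose_item_def wp.simps(3)
    by (rule 1[unfolded wp.simps(3)], rule 2[unfolded wp.simps(3)], rule 3, rule 4)
qed

lemma candidate_le: "k < 2 * n + 1 \<Longrightarrow> \<bar>prepared n k\<bar> \<le> 2 * M"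
  using Z_le[of k] coeff_le(2)[of "k - n"] M_ge_1 by (auto simp: prepared_def)

lemma item_le: "i < n \<Longrightarrow> \<bar>w\<bar> \<le> 2 * M \<Longrightarrow> \<bar>item w i\<bar> \<le> 5 * M ^ 2"
  using choose_bounds(6,8)[of i w] by (auto simp: item_def min_def)

text \<open>There are at most \<open>M\<close> items of size \<open>5 * M ^ 2\<close>, and
  \<open>A * w\<close> adds at most \<open>2 * M ^ 2\<close>. The search subtracts two totals, which
  stays within \<open>14 * M ^ 3\<close> and hence within \<open>B\<close>.\<close>

lemma total_le:
  assumes "\<bar>w\<bar> \<le> 2 * M" "j \<le> n"
  shows "\<bar>total w j\<bar> \<le> 7 * M ^ 3"
proof -
  have "\<bar>\<Sum>i<j. item w i\<bar> \<le> (\<Sum>i<j. 5 * M ^ 2)"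
    using assms by (intro order.trans[OF sum_abs sum_mono]) (auto intro: item_le)
  also have "\<dots> \<le> M * (5 * M ^ 2)"
    using assms n_bounds(1) by (simp add: mult_right_mono)
  also have "\<dots> = 5 * M ^ 3" by (simp add: power2_eq_square power3_eq_cube)
  finally have 1: "\<bar>\<Sum>i<j. item w i\<bar> \<le> 5 * M ^ 3" .
  have "\<bar>A * w\<bar> \<le> 2 * M ^ 2"
    using abs_mult_le[OF coeff_le(3) assms(1)] by (simp add: power2_eq_square)
  then have "\<bar>A * w\<bar> \<le> 2 * M ^ 3" using M_powers(2) by linarith
  then show ?thesis using 1 unfolding total_def by linarith
qed

lemma total_le_B: "\<bar>w\<bar> \<le> 2 * M \<Longrightarrow> j \<le> n \<Longrightarrow> \<bar>total w j\<bar> \<le> B"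
  using total_le[of w j] B_ge M_powers(3) by linarith

section \<open>Search over the candidates\<close>

definition best_of :: "nat \<Rightarrow> (int \<Rightarrow> int) \<Rightarrow> bool" where
  "best_of j X \<longleftrightarrow> (0 < j \<longrightarrow> (\<exists>k<j. X rBestW = prepared n k \<and> X rBest = total (X rBestW) n \<and>
     (\<forall>k'<j. X rBest \<le> total (prepared n k') n)))"

definition searching :: "nat \<Rightarrow> (int \<Rightarrow> int) \<Rightarrow> bool" where
  "searching j X \<longleftrightarrow> ready X \<and> arr X (prepared n) (4 * n + 1) \<and> best_of j X"

lemmas searching_defs = searching_def ready_def base_def best_of_def

lemma ht_try_candidate:
  assumes j: "j < 2 * n + 1"
  shows "ht N B (\<lambda>(X, inp, out). searching j X \<and> X rI = int j \<and> out = []) try_candidate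
    (\<lambda>(X, inp, out). searching (Suc j) X \<and> X rI = int j \<and> out = [])"
proof -
  define w where "w = prepared n j"
  have w: "\<bar>w\<bar> \<le> 2 * M" using candidate_le[OF j] by (simp add: w_def)
  have wB: "\<bar>w\<bar> \<le> B" using w linear_le_B(1) M_ge_1 by linarith
  define I where "I i = (\<lambda>(X, inp :: int list, out). searching j X \<and> X rI = int j \<and> X rW = w \<and>
    X rVal = total w i \<and> out = ([] :: int list))" for i
  have "ht N B (\<lambda>(X, inp, out). searching j X \<and> X rI = int j \<and> out = [])
      (block [LoadI rW rI, MulI rVal rA rW]) (I 0)"
  proof (rule ht_wpI)
    fix X :: "int \<Rightarrow> int" and inp out :: "int list"
    assume *: "case (X, inp, out) of (X, inp, out) \<Rightarrow> searching j X \<and> X rI = int j \<and> out = []"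
    then have "X (int j) = w"
      using j arrD[of X "prepared n" "4 * n + 1" j] by (simp add: searching_def w_def)
    then show "wp B (block [LoadI rW rI, MulI rVal rA rW]) (I 0) (X, inp, out)"
      using * total_le_B[OF w, of 0] by (simp add: I_def searching_defs total_def)
  qed
  moreover have "ht N B (I 0) (For rJ rN rU (choose_item ;; Do (AddI rVal rVal rG))) (I n)"
  proof (rule ht_For)
    fix i assume i: "i < n"
    show "ht N B (\<lambda>s. I i s \<and> fst s rJ = int i) (choose_item ;; Do (AddI rVal rVal rG))
      (\<lambda>s. I (Suc i) s \<and> fst s rJ = int i)"
    proof (rule ht_wpI)
      fix X :: "int \<Rightarrow> int" and inp out :: "int list"
      assume *: "I i (X, inp, out) \<and> fst (X, inp, out) rJ = int i"
      have "wp B choose_item (wp B (Do (AddI rVal rVal rG)) (\<lambda>s. I (Suc i) s \<and> fst s rJ = int i))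
        (X, inp, out)"
        by (rule wp_choose_item[where w = w and i = i])
          (use * i w total_le_B[OF w, of "Suc i"] in \<open>auto simp: I_def searching_defs total_def add.assoc\<close>)
      then show "wp B (choose_item ;; Do (AddI rVal rVal rG)) (\<lambda>s. I (Suc i) s \<and> fst s rJ = int i)
        (X, inp, out)"
        by simp
    qed
  qed (use n_bounds in \<open>auto simp: I_def searching_defs\<close>)
  moreover have "ht N B (I n)
      (Cond rI (Do (SubI rV rBest rVal) ;; Cond rV update_best Skip) update_best)
      (\<lambda>(X, inp, out). searching (Suc j) X \<and> X rI = int j \<and> out = [])"
  proof (rule ht_wpI)
    fix X :: "int \<Rightarrow> int" and inp out :: "int list"
    assume *: "I n (X, inp, out)"
    note val = total_le_B[OF w, of n]
    show "wp B (Cond rI (Do (SubI rV rBest rVal) ;; Cond rV update_best Skip) update_best)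
      (\<lambda>(X, inp, out). searching (Suc j) X \<and> X rI = int j \<and> out = []) (X, inp, out)"
    proof (cases "j = 0")
      case True
      then show ?thesis
        using * val wB by (simp add: I_def searching_defs update_best_def w_def)
    next
      case False
      then obtain k where k: "k < j" "X rBestW = prepared n k" "X rBest = total (prepared n k) n"
        and le: "\<forall>k'<j. X rBest \<le> total (prepared n k') n"
        using * by (auto simp: I_def searching_defs)
      have "\<bar>X rBest\<bar> \<le> 7 * M ^ 3"
        using total_le[OF candidate_le, of k n] k j by simp
      then have "\<bar>X rBest - total w n\<bar> \<le> B"
        using total_le[OF w, of n] B_ge M_powers(3) by linarith
      moreover have "best_of (Suc j) (X(rV := v, rBest := total w n, rBestW := w))"
        if "total w n < X rBest" for v
        using le that unfolding best_of_def w_def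
        by (intro impI exI[of _ j]) (auto simp: less_Suc_eq)
      moreover have "best_of (Suc j) (X(rV := v))" if "X rBest \<le> total w n" for v
        using le that k unfolding best_of_def w_def
        by (intro impI exI[of _ k]) (auto simp: less_Suc_eq)
      ultimately show ?thesis
        using * val wB False by (simp add: I_def searching_def ready_def base_def update_best_def)
    qed
  qed
  ultimately show ?thesis
    unfolding try_candidate_def by (intro ht_Seq)
qed

section \<open>Output of the optimum and the branch on unboundedness\<close>

definition answer :: "int \<Rightarrow> int list" where
  "answer w = [1, w, D] @ concat (map (\<lambda>i. [y_opt w i, D]) [0..<n]) @
     concat (map (\<lambda>i. [x_opt w i, 1]) [0..<n])"

text \<open>The registers \<open>u\<close> and \<open>v\<close> are parameters so that one proof
  serves both output passes, \<open>y\<close> over \<open>D\<close> and \<open>x\<close> over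
  1.\<close>

lemma ht_write_items:
  assumes w: "\<bar>w\<bar> \<le> 2 * M"
    and regs: "\<And>X i. X rY = y_opt w i \<Longrightarrow> X rX = x_opt w i \<Longrightarrow> base X \<Longrightarrow> X u = f i \<and> X v = g i"
  shows "ht N B
    (\<lambda>(X, inp, out). ready X \<and> arr X (prepared n) (4 * n + 1) \<and> X rW = w \<and> out = out0)
    (For rJ rN rU (choose_item ;; block [WriteI u, WriteI v]))
    (\<lambda>(X, inp, out). ready X \<and> arr X (prepared n) (4 * n + 1) \<and> X rW = w \<and>
       out = out0 @ concat (map (\<lambda>i. [f i, g i]) [0..<n]))"
proof -
  define I where "I j = (\<lambda>(X, inp :: int list, out). ready X \<and> arr X (prepared n) (4 * n + 1) \<and>
    X rW = w \<and> out = out0 @ concat (map (\<lambda>i. [f i, g i]) [0..<j]))" for j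
  have "ht N B (I 0) (For rJ rN rU (choose_item ;; block [WriteI u, WriteI v])) (I n)"
  proof (rule ht_For)
    fix i assume i: "i < n"
    show "ht N B (\<lambda>s. I i s \<and> fst s rJ = int i) (choose_item ;; block [WriteI u, WriteI v])
      (\<lambda>s. I (Suc i) s \<and> fst s rJ = int i)"
    proof (rule ht_wpI)
      fix X :: "int \<Rightarrow> int" and inp out :: "int list"
      assume *: "I i (X, inp, out) \<and> fst (X, inp, out) rJ = int i"
      have "wp B choose_item (wp B (block [WriteI u, WriteI v]) (\<lambda>s. I (Suc i) s \<and> fst s rJ = int i))
        (X, inp, out)"
      proof (rule wp_choose_item[where w = w and i = i])
        fix v1 v2 v3 v4
        let ?X = "X(rP := v1, rQ := v2, rR := v3, rV := v4, rG := item w i,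
          rY := y_opt w i, rX := x_opt w i)"
        have "?X u = f i \<and> ?X v = g i"
          using * by (intro regs) (auto simp: I_def ready_def base_def)
        then show "wp B (block [WriteI u, WriteI v]) (\<lambda>s. I (Suc i) s \<and> fst s rJ = int i) (?X, inp, out)"
          using * by (simp add: I_def ready_def base_def del: fun_upd_apply)
            (simp add: I_def ready_def base_def)
      qed (use * i w in \<open>auto simp: I_def\<close>)
      then show "wp B (choose_item ;; block [WriteI u, WriteI v])
        (\<lambda>s. I (Suc i) s \<and> fst s rJ = int i) (X, inp, out)"
        by simp
    qed
  qed (use n_bounds in \<open>auto simp: I_def ready_def base_def\<close>)
  then show ?thesis by (rule ht_conseq) (auto simp: I_def)
qed

lemma ht_write_optimum:
  assumes w: "\<bar>w\<bar> \<le> 2 * M"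
  shows "ht N B
    (\<lambda>(X, inp, out). ready X \<and> arr X (prepared n) (4 * n + 1) \<and> X rBestW = w \<and> out = [])
    write_optimum (\<lambda>(X, inp, out). out = answer w)"
proof -
  have "\<bar>w\<bar> \<le> B" using w linear_le_B(1) M_ge_1 by linarith
  then have "ht N B
    (\<lambda>(X, inp, out). ready X \<and> arr X (prepared n) (4 * n + 1) \<and> X rBestW = w \<and> out = [])
    (block [AddI rW rBestW rZero, WriteI rOne, WriteI rW, WriteI rD])
    (\<lambda>(X, inp, out). ready X \<and> arr X (prepared n) (4 * n + 1) \<and> X rW = w \<and> out = [1, w, D])"
    by (intro ht_wpI) (auto simp: ready_def base_def)
  moreover have "ht N B
    (\<lambda>(X, inp, out). ready X \<and> arr X (prepared n) (4 * n + 1) \<and> X rW = w \<and> out = [1, w, D])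
    (For rJ rN rU (choose_item ;; block [WriteI rY, WriteI rD]))
    (\<lambda>(X, inp, out). ready X \<and> arr X (prepared n) (4 * n + 1) \<and> X rW = w \<and>
       out = [1, w, D] @ concat (map (\<lambda>i. [y_opt w i, D]) [0..<n]))"
    by (rule ht_write_items[OF w]) (auto simp: base_def)
  moreover have "ht N B
    (\<lambda>(X, inp, out). ready X \<and> arr X (prepared n) (4 * n + 1) \<and> X rW = w \<and>
       out = [1, w, D] @ concat (map (\<lambda>i. [y_opt w i, D]) [0..<n]))
    (For rJ rN rU (choose_item ;; block [WriteI rX, WriteI rOne]))
    (\<lambda>(X, inp, out). out = answer w)"
    by (rule ht_conseq[OF ht_write_items[OF w, where f = "x_opt w" and g = "\<lambda>_. 1"]])
      (auto simp: base_def answer_def)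
  ultimately show ?thesis
    unfolding write_optimum_def by (intro ht_Seq)
qed

definition unbounded :: bool where
  "unbounded \<longleftrightarrow> A < 0 \<or> (\<exists>i<n. b i < 0) \<or> A > (\<Sum>i<n. b i)"

lemma ht_optimize:
  "ht N B
     (\<lambda>(X, inp, out). ready X \<and> (X rFlag > 0 \<longleftrightarrow> unbounded) \<and> arr X (prepared n) (4 * n + 1) \<and> out = [])
     optimize
     (\<lambda>(X, inp, out). if unbounded then out = [0] else
        \<exists>k<2 * n + 1. out = answer (prepared n k) \<and>
          (\<forall>k'<2 * n + 1. total (prepared n k) n \<le> total (prepared n k') n))"
    (is "ht N B ?P optimize ?Q")
proof -
  have unbounded: "ht N B (\<lambda>s. ?P s \<and> fst s rFlag > 0) (Do (WriteI rZero)) ?Q"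
    by (rule ht_wpI) (auto simp: ready_def base_def)
  define I where "I j = (\<lambda>(X, inp :: int list, out). searching j X \<and> out = ([] :: int list))" for j
  have search: "ht N B (I 0) (For rI rPB rT try_candidate) (I (2 * n + 1))"
  proof (rule ht_For)
    fix j assume "j < 2 * n + 1"
    from ht_try_candidate[OF this]
    show "ht N B (\<lambda>s. I j s \<and> fst s rI = int j) try_candidate (\<lambda>s. I (Suc j) s \<and> fst s rI = int j)"
      by (rule ht_conseq) (auto simp: I_def)
  qed (use n_bounds in \<open>auto simp: I_def searching_defs\<close>)
  have "ht N B (I (2 * n + 1)) write_optimum
     (\<lambda>(X, inp, out). \<exists>k<2 * n + 1. out = answer (prepared n k) \<and>
          (\<forall>k'<2 * n + 1. total (prepared n k) n \<le> total (prepared n k') n))" (is "ht N B ?I _ ?R")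
  proof -
    \<comment> \<open>Which candidate is best is known only from the final state of the search. The
      triple is therefore proved for each \<open>k\<close>, and the existential over
      \<open>k\<close> is eliminated afterwards.\<close>
    have "ht N B (\<lambda>s. ?I s \<and> (fst s rBestW = prepared n k \<and>
        (\<forall>k'<2 * n + 1. total (prepared n k) n \<le> total (prepared n k') n))) write_optimum ?R"
      if k: "k < 2 * n + 1" for k
      unfolding ht_def
    proof (intro allI impI, elim conjE)
      fix prog p s
      assume *: "code_at prog p (compile p write_optimum)" "?I s" "fst s rBestW = prepared n k"
        "\<forall>k'<2 * n + 1. total (prepared n k) n \<le> total (prepared n k') n" "bounded B s"
      have "case s of (X, inp, out) \<Rightarrow> ready X \<and> arr X (prepared n) (4 * n + 1) \<and>
          X rBestW = prepared n k \<and> out = []"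
        using *(2,3) by (auto simp: I_def searching_def)
      then obtain s' where "reaches prog B (p, s) (steps N write_optimum) (p + csize write_optimum, s')"
          "case s' of (X, inp, out) \<Rightarrow> out = answer (prepared n k)" "bounded B s'"
        using ht_write_optimum[OF candidate_le[OF k]] *(1,5) unfolding ht_def by blast
      then show "\<exists>s'. reaches prog B (p, s) (steps N write_optimum) (p + csize write_optimum, s') \<and>
          ?R s' \<and> bounded B s'"
        using *(4) k by (intro exI[of _ s']) auto
    qed
    moreover have "\<exists>k<2 * n + 1. fst s rBestW = prepared n k \<and>
        (\<forall>k'<2 * n + 1. total (prepared n k) n \<le> total (prepared n k') n)" if "?I s" for s
      using that by (auto simp: I_def searching_defs)
    ultimately show ?thesis unfolding ht_def by meson
  qed
  with search have "ht N B (I 0) (For rI rPB rT try_candidate ;; write_optimum) ?R"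
    by (rule ht_Seq)
  note bounded_case = this
  have "ht N B (\<lambda>s. ?P s \<and> \<not> fst s rFlag > 0)
      (For rI rPB rT try_candidate ;; write_optimum) ?Q"
  proof (cases unbounded)
    case True
    then show ?thesis by (auto simp: ht_def)
  next
    case False
    then show ?thesis
      by (intro ht_conseq[OF bounded_case]) (auto simp: I_def searching_def best_of_def)
  qed
  with unbounded show ?thesis
    unfolding optimize_def by (rule ht_Cond)
qed

end

section \<open>Reduction to the breakpoints\<close>

definition lin_obj :: "nat \<Rightarrow> real \<Rightarrow> (nat \<Rightarrow> real) \<Rightarrow> (nat \<Rightarrow> real) \<Rightarrow> real \<times> real list \<times> real list \<Rightarrow> real" where
  "lin_obj n a b e = (\<lambda>(w, y, x). a * w + (\<Sum>i<n. b i * y ! i) + (\<Sum>i<n. e i * x ! i))"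

text \<open>With \<open>x = 0\<close> there are three feasible rays: raise \<open>w\<close>, raise
  one \<open>y j\<close>, or lower \<open>w\<close> while raising every \<open>y i\<close> equally.
  The objective has slope \<open>a\<close>, \<open>b j\<close>, and the sum of the
  \<open>b i\<close> minus \<open>a\<close> along them.\<close>

lemma lin_obj_unbounded:
  assumes "a < 0 \<or> (\<exists>i<n. b i < 0) \<or> a > (\<Sum>i<n. b i)"
  shows "\<exists>z\<in>P_MCMIX n q c. lin_obj n a b e z < (L :: real)"
proof -
  define s where "s = (\<Sum>i<n. \<bar>q ! i\<bar>)"
  have q: "q ! i \<le> s" if "i < n" for i
    using member_le_sum[of i "{..<n}" "\<lambda>i. \<bar>q ! i\<bar>"] that by (simp add: s_def)
  from assms consider (w) "a < 0" | (y) j where "j < n" "b j < 0" | (wy) "a > (\<Sum>i<n. b i)" by blast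
  then show ?thesis
  proof cases
    case w
    \<comment> \<open>The point with \<open>w = s\<close> is feasible. The added length lowers the
      objective by enough to cancel \<open>a * s\<close> and fall below \<open>L\<close>;
      \<open>t\<close> and the later \<open>K\<close> are chosen in the same way.\<close>
    define K where "K = s + (\<bar>L\<bar> + 1 + \<bar>a * s\<bar>) / (- a)"
    have "0 \<le> (\<bar>L\<bar> + 1 + \<bar>a * s\<bar>) / (- a)" using w by (intro divide_nonneg_pos) auto
    then have "q ! i \<le> K" if "i < n" for i using q[OF that] unfolding K_def by linarith
    then have "(K, replicate n 0, replicate n 0) \<in> P_MCMIX n q c"
      by (simp add: P_MCMIX_def)
    moreover have "a * K = a * s - (\<bar>L\<bar> + 1 + \<bar>a * s\<bar>)" using w by (simp add: K_def field_simps)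
    then have "lin_obj n a b e (K, replicate n 0, replicate n 0) < L" by (simp add: lin_obj_def)
    ultimately show ?thesis by blast
  next
    case y
    define t where "t = (\<bar>L\<bar> + 1 + \<bar>a * s\<bar>) / (- b j)"
    have "0 \<le> t" using y unfolding t_def by (intro divide_nonneg_pos) auto
    moreover have "q ! j \<le> s + t" if "0 \<le> t" using q[OF y(1)] that by linarith
    ultimately have "(s, (replicate n 0)[j := t], replicate n 0) \<in> P_MCMIX n q c"
      using q y(1) by (auto simp: P_MCMIX_def nth_list_update)
    moreover have "(\<Sum>i<n. b i * (replicate n 0)[j := t] ! i) = (\<Sum>i<n. if i = j then b j * t else 0)"
      by (intro sum.cong) (auto simp: nth_list_update)
    then have "(\<Sum>i<n. b i * (replicate n 0)[j := t] ! i) = b j * t" using y by simp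
    moreover have "b j * t = - (\<bar>L\<bar> + 1 + \<bar>a * s\<bar>)" using y by (simp add: t_def field_simps)
    ultimately show ?thesis
      by (intro bexI[of _ "(s, (replicate n 0)[j := t], replicate n 0)"]) (simp_all add: lin_obj_def)
  next
    case wy
    define u where "u = (\<Sum>i<n. b i * \<bar>q ! i\<bar>)"
    define K where "K = (\<bar>L\<bar> + 1 + \<bar>u\<bar>) / (a - (\<Sum>i<n. b i))"
    have K: "0 \<le> K" using wy unfolding K_def by (intro divide_nonneg_pos) auto
    have "(- K, map (\<lambda>i. \<bar>q ! i\<bar> + K) [0..<n], replicate n 0) \<in> P_MCMIX n q c"
      using K by (auto simp: P_MCMIX_def)
    moreover have "K * (a - (\<Sum>i<n. b i)) = \<bar>L\<bar> + 1 + \<bar>u\<bar>" using wy by (simp add: K_def)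
    then have "lin_obj n a b e (- K, map (\<lambda>i. \<bar>q ! i\<bar> + K) [0..<n], replicate n 0) < L"
      by (simp add: lin_obj_def u_def distrib_left sum.distrib flip: sum_distrib_right)
        (simp add: right_diff_distrib mult.commute)
    ultimately show ?thesis by blast
  qed
qed

text \<open>
  Moving \<open>w\<close> to the next breakpoint on the side where the linear piece does not increase.
\<close>

lemma breakpoint_minimizer:
  fixes a :: real and b p :: "nat \<Rightarrow> real" and n :: nat
  defines "h \<equiv> \<lambda>w. a * w + (\<Sum>i<n. b i * max 0 (p i - w))"
  assumes a: "0 \<le> a" "a \<le> (\<Sum>i<n. b i)" and b: "\<And>i. i < n \<Longrightarrow> 0 \<le> b i" and n: "0 < n"
  shows "\<exists>i<n. h (p i) \<le> h w"
proof -
  define H where "H = {i. i < n \<and> w < p i}"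
  have fin: "finite H" by (simp add: H_def)
  have sum_H: "(\<Sum>i<n. if i \<in> H then f i else 0) = sum f H" for f :: "nat \<Rightarrow> real"
    by (subst sum.inter_restrict[symmetric]) (auto simp: H_def intro!: sum.cong)
  have hw: "h w = a * w + (\<Sum>i\<in>H. b i * (p i - w))"
    unfolding h_def sum_H[symmetric] by (auto simp: H_def intro!: sum.cong)
  \<comment> \<open>The conditions on \<open>v\<close> exclude breakpoints strictly between
    \<open>w\<close> and \<open>v\<close>, so \<open>h\<close> is affine there, with slope
    \<open>a\<close> minus the weights of the terms positive at \<open>w\<close>.\<close>
  have move: "h v = h w + (a - sum b H) * (v - w)"
    if v: "\<And>i. i < n \<Longrightarrow> i \<in> H \<Longrightarrow> v \<le> p i" "\<And>i. i < n \<Longrightarrow> i \<notin> H \<Longrightarrow> p i \<le> v" for v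
  proof -
    have "(\<Sum>i<n. b i * max 0 (p i - v)) = (\<Sum>i<n. if i \<in> H then b i * (p i - v) else 0)"
    proof (rule sum.cong[OF HOL.refl])
      fix i assume "i \<in> {..<n}"
      then show "b i * max 0 (p i - v) = (if i \<in> H then b i * (p i - v) else 0)"
        using v[of i] by (cases "i \<in> H") auto
    qed
    then have "h v = a * v + (\<Sum>i\<in>H. b i * (p i - v))"
      unfolding sum_H by (simp add: h_def)
    moreover have "(\<Sum>i\<in>H. b i * (p i - u)) = (\<Sum>i\<in>H. b i * p i) - sum b H * u" for u
      by (simp add: right_diff_distrib sum_subtractf sum_distrib_right)
    ultimately show ?thesis unfolding hw by (simp add: algebra_simps)
  qed
  show ?thesis
  proof (cases "sum b H \<le> a \<and> H \<noteq> {..<n}")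
    case True
    define v where "v = Max (p ` ({..<n} - H))"
    have ne: "{..<n} - H \<noteq> {}" using True by (auto simp: H_def)
    then have "v \<in> p ` ({..<n} - H)" unfolding v_def by (intro Max_in) auto
    then obtain k where k: "k < n" "k \<notin> H" "v = p k" by auto
    have "h v = h w + (a - sum b H) * (v - w)"
    proof (rule move)
      show "v \<le> p i" if "i < n" "i \<in> H" for i using that k by (auto simp: H_def)
      show "p i \<le> v" if "i < n" "i \<notin> H" for i using that unfolding v_def by (intro Max_ge) auto
    qed
    moreover have "(a - sum b H) * (v - w) \<le> 0"
      using True k by (intro mult_nonneg_nonpos) (auto simp: H_def)
    ultimately show ?thesis using k by auto
  next
    case False
    \<comment> \<open>If all breakpoints lie above \<open>w\<close>, the slope is nonpositive by the
      upper bound on \<open>a\<close>.\<close>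
    then have le: "a \<le> sum b H" using a by auto
    \<comment> \<open>An empty \<open>H\<close> would give the slope \<open>a\<close>, which is
      nonnegative, with some breakpoint at or below \<open>w\<close>: this is the first
      case.\<close>
    have ne: "H \<noteq> {}" using False a n by auto
    define v where "v = Min (p ` H)"
    have "v \<in> p ` H" unfolding v_def using fin ne by (intro Min_in) auto
    then obtain k where k: "k \<in> H" "v = p k" by auto
    have "h v = h w + (a - sum b H) * (v - w)"
    proof (rule move)
      show "v \<le> p i" if "i < n" "i \<in> H" for i using that fin unfolding v_def by (intro Min_le) auto
      show "p i \<le> v" if "i < n" "i \<notin> H" for i using that k by (auto simp: H_def)
    qed
    moreover have "(a - sum b H) * (v - w) \<le> 0"
      using le k by (intro mult_nonpos_nonneg) (auto simp: H_def)
    ultimately show ?thesis using k by (auto simp: H_def)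
  qed
qed

definition item_cost :: "real \<Rightarrow> real \<Rightarrow> real \<Rightarrow> real \<Rightarrow> real \<Rightarrow> real" where
  "item_cost q r b e w = min (b * max 0 (q - w)) (e + b * max 0 (r - w))"

text \<open>For nonnegative \<open>b\<close> and \<open>r i = q i - c i\<close>, this is the
  objective minimised over \<open>y\<close> and \<open>x\<close> at fixed \<open>w\<close>. As a sum
  of minima it is in general not convex.\<close>

definition reduced :: "nat \<Rightarrow> (nat \<Rightarrow> real) \<Rightarrow> (nat \<Rightarrow> real) \<Rightarrow> real \<Rightarrow> (nat \<Rightarrow> real) \<Rightarrow> (nat \<Rightarrow> real) \<Rightarrow> real \<Rightarrow> real" where
  "reduced n q r a b e w = a * w + (\<Sum>i<n. item_cost (q i) (r i) (b i) (e i) w)"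

text \<open>Freeze for each item the branch that is cheaper at \<open>w\<close>. The resulting
  function, a constant plus a convex \<open>h\<close>, agrees with \<open>reduced\<close> at
  \<open>w\<close> and dominates it elsewhere, so a good breakpoint of \<open>h\<close> is good for
  \<open>reduced\<close>.\<close>

lemma reduced_minimizer:
  assumes a: "0 \<le> a" "a \<le> (\<Sum>i<n. b i)" and b: "\<And>i. i < n \<Longrightarrow> 0 \<le> b i" and n: "0 < n"
  shows "\<exists>v \<in> q ` {..<n} \<union> r ` {..<n}. reduced n q r a b e v \<le> reduced n q r a b e w"
proof -
  define P where "P i \<longleftrightarrow> b i * max 0 (q i - w) \<le> e i + b i * max 0 (r i - w)" for i
  define p where "p i = (if P i then q i else r i)" for i
  define d where "d i = (if P i then 0 else e i)" for i
  define h where "h v = a * v + (\<Sum>i<n. b i * max 0 (p i - v))" for v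
  obtain k where k: "k < n" "h (p k) \<le> h w"
    using breakpoint_minimizer[OF a b n, of p w] by (auto simp: h_def)
  have "item_cost (q i) (r i) (b i) (e i) v \<le> d i + b i * max 0 (p i - v)" for i v
    by (auto simp: item_cost_def d_def p_def)
  then have "reduced n q r a b e (p k) \<le> a * p k + (\<Sum>i<n. d i + b i * max 0 (p i - p k))"
    unfolding reduced_def by (intro add_left_mono sum_mono)
  also have "\<dots> = sum d {..<n} + h (p k)" by (simp add: h_def sum.distrib)
  also have "\<dots> \<le> sum d {..<n} + h w" using k by simp
  also have "\<dots> = a * w + (\<Sum>i<n. d i + b i * max 0 (p i - w))" by (simp add: h_def sum.distrib)
  also have "\<dots> = reduced n q r a b e w"
    unfolding reduced_def by (intro arg_cong2[where f = "(+)"] sum.cong)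
      (auto simp: item_cost_def d_def p_def P_def)
  finally show ?thesis using k by (intro bexI[of _ "p k"]) (auto simp: p_def)
qed

lemma reduced_le_lin_obj:
  assumes z: "(w, y, x) \<in> P_MCMIX n q c" and b: "\<And>i. i < n \<Longrightarrow> 0 \<le> b i"
  shows "reduced n (\<lambda>i. q ! i) (\<lambda>i. q ! i - c ! i) a b e w \<le> lin_obj n a b e (w, y, x)"
proof -
  have "item_cost (q ! i) (q ! i - c ! i) (b i) (e i) w \<le> b i * y ! i + e i * x ! i" if i: "i < n" for i
  proof -
    have f: "0 \<le> y ! i" "x ! i = 0 \<or> x ! i = 1" "q ! i - c ! i * x ! i - y ! i \<le> w"
      using z i by (auto simp: P_MCMIX_def)
    from f(2) show ?thesis
    proof
      assume x: "x ! i = 0"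
      then have "b i * max 0 (q ! i - w) \<le> b i * y ! i"
        using f b[OF i] by (intro mult_left_mono) auto
      then show ?thesis using x by (simp add: item_cost_def min.coboundedI1)
    next
      assume x: "x ! i = 1"
      then have "b i * max 0 (q ! i - c ! i - w) \<le> b i * y ! i"
        using f b[OF i] by (intro mult_left_mono) auto
      then show ?thesis using x by (simp add: item_cost_def min.coboundedI2)
    qed
  qed
  then have "(\<Sum>i<n. item_cost (q ! i) (q ! i - c ! i) (b i) (e i) w) \<le> (\<Sum>i<n. b i * y ! i + e i * x ! i)"
    by (intro sum_mono) auto
  then show ?thesis by (simp add: reduced_def lin_obj_def sum.distrib)
qed

section \<open>Correctness and running time\<close>

lemma abs_le_power2_int_size: "\<bar>v\<bar> \<le> 2 ^ int_size v"
proof (cases "v = 0")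
  case False
  then have "\<bar>v\<bar> < 2 ^ nat (bitlen \<bar>v\<bar>)" using bitlen_bounds[of "\<bar>v\<bar>"] by simp
  also have "\<dots> \<le> 2 ^ int_size v" by (intro power_increasing) (auto simp: int_size_def)
  finally show ?thesis by simp
qed simp

lemma int_size_power2: "int_size (2 ^ k) = k + 2"
  using bitlen_pow2[of 1 k] by (simp add: int_size_def bitlen_alt_def)

lemma length_le_code_size: "length ks \<le> code_size ks"
  by (induction ks) (auto simp: code_size_def int_size_def)

lemma int_size_le_code_size: "v \<in> set ks \<Longrightarrow> int_size v \<le> code_size ks"
  by (simp add: code_size_def member_le_sum_list)

lemma length_flat: "length (flat fs) = 2 * length fs"
  by (induction fs) (auto simp: flat_def)

lemma code_size_flat:
  "code_size (flat fs) = (\<Sum>l<length fs. int_size (fst (fs ! l)) + int_size (snd (fs ! l)))"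
proof -
  have "code_size (flat fs) = (\<Sum>f\<leftarrow>fs. int_size (fst f) + int_size (snd f))"
    by (induction fs) (auto simp: flat_def code_size_def)
  then show ?thesis by (simp add: sum_list_sum_nth atLeast0LessThan)
qed

text \<open>Both \<open>num\<close> and \<open>den\<close> take one factor from each fraction, so
  their bit lengths are charged to disjoint parts of the input.\<close>

lemma abs_prod_le_power2:
  assumes "k \<le> length fs" "\<And>l. l < k \<Longrightarrow> v l = fst (fs ! l) \<or> v l = snd (fs ! l)"
  shows "\<bar>\<Prod>l<k. v l\<bar> \<le> 2 ^ code_size (flat fs)"
proof -
  have "\<bar>\<Prod>l<k. v l\<bar> \<le> (\<Prod>l<k. 2 ^ (int_size (fst (fs ! l)) + int_size (snd (fs ! l))))"
    unfolding abs_prod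
  proof (rule prod_mono, intro conjI)
    fix l assume "l \<in> {..<k}"
    then have "int_size (v l) \<le> int_size (fst (fs ! l)) + int_size (snd (fs ! l))"
      using assms(2)[of l] by auto
    then have "(2 :: int) ^ int_size (v l) \<le> 2 ^ (int_size (fst (fs ! l)) + int_size (snd (fs ! l)))"
      by (intro power_increasing) auto
    then show "\<bar>v l\<bar> \<le> 2 ^ (int_size (fst (fs ! l)) + int_size (snd (fs ! l)))"
      using abs_le_power2_int_size[of "v l"] by linarith
  qed simp
  also have "\<dots> = 2 ^ (\<Sum>l<k. int_size (fst (fs ! l)) + int_size (snd (fs ! l)))"
    by (simp add: power_sum)
  also have "\<dots> \<le> 2 ^ code_size (flat fs)"
    unfolding code_size_flat using assms(1) by (intro power_increasing sum_mono2) auto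
  finally show ?thesis .
qed

lemma den_pos: "k \<le> length fs \<Longrightarrow> \<forall>(a, d)\<in>set fs. d > 0 \<Longrightarrow> 0 < den fs k"
  unfolding den_def by (intro prod_pos) (auto simp: split_beta)

lemma num_over_den:
  assumes "k < length fs" "\<forall>(a, d)\<in>set fs. d > 0"
  shows "of_rat (Fract (fst (fs ! k)) (snd (fs ! k))) =
    (real_of_int (num fs (length fs) k) / real_of_int (den fs (length fs)))"
proof -
  have d: "snd (fs ! k) \<noteq> 0" using assms nth_mem[OF assms(1)] by fastforce
  define R where "R = (\<Prod>l\<in>{..<length fs} - {k}. snd (fs ! l))"
  have "den fs (length fs) = snd (fs ! k) * R"
    unfolding den_def R_def using assms by (intro prod.remove) auto
  moreover have "num fs (length fs) k = fst (fs ! k) * R"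
    unfolding num_def R_def using assms by (subst prod.remove[of _ k]) (auto intro!: prod.cong)
  moreover have "0 < den fs (length fs)" using den_pos assms by blast
  ultimately show ?thesis using d by (auto simp: of_rat_rat field_simps)
qed

definition mcmix_program :: com where
  "mcmix_program = read_instance ;; prepare ;; optimize"

section \<open>From scaled integers back to the rational instance\<close>

context scaled_data
begin

definition real_data :: "nat \<Rightarrow> real" where "real_data k = of_int (Z k) / of_int D"

text \<open>The integer and the real objective differ by a positive factor, so comparing totals on
  the machine compares true values.\<close>

lemma reduced_total:
  "reduced n (\<lambda>i. of_int (q i) / of_int D) (\<lambda>i. of_int (r i) / of_int D) (of_int A / of_int D)
     (\<lambda>i. of_int (b i) / of_int D) (\<lambda>i. of_int (e i) / of_int D) (of_int w / of_int D)
   = of_int (total w n) / of_int D ^ 2"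
proof -
  have D: "0 < real_of_int D" using D_pos by simp
  have m: "max 0 (real_of_int x / real_of_int D - of_int w / of_int D) = of_int (max 0 (x - w)) / of_int D" for x
    using D by (auto simp: max_def field_simps)
  have "item_cost (of_int (q i) / of_int D) (of_int (r i) / of_int D) (of_int (b i) / of_int D)
      (of_int (e i) / of_int D) (of_int w / of_int D) = of_int (item w i) / of_int D ^ 2" for i
  proof -
    have "of_int (b i) / real_of_int D * (of_int (y0 w i) / of_int D) = of_int (cost0 w i) / of_int D ^ 2"
      by (simp add: cost0_def power2_eq_square)
    moreover have "of_int (e i) / real_of_int D + of_int (b i) / of_int D * (of_int (y1 w i) / of_int D) =
        of_int (cost1 w i) / of_int D ^ 2"
      using D by (simp add: cost1_def power2_eq_square field_simps)
    ultimately show ?thesis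
      using D unfolding item_cost_def m y0_def[symmetric] y1_def[symmetric]
      by (simp add: item_def min_def divide_le_cancel)
  qed
  then show ?thesis
    by (simp add: reduced_def total_def add_divide_distrib sum_divide_distrib power2_eq_square)
qed

definition solution :: "int \<Rightarrow> mcmix_answer" where
  "solution w = Optimal (Fract w D) (map (\<lambda>i. Fract (y_opt w i) D) [0..<n])
     (map (\<lambda>i. Fract (x_opt w i) 1) [0..<n])"

lemma solution_code: "mcmix_answer_code (solution w) (answer w)"
proof -
  define gs where "gs = [(w, D)] @ map (\<lambda>i. (y_opt w i, D)) [0..<n] @ map (\<lambda>i. (x_opt w i, 1)) [0..<n]"
  have "rats_code (Fract w D # map (\<lambda>i. Fract (y_opt w i) D) [0..<n] @
      map (\<lambda>i. Fract (x_opt w i) 1) [0..<n]) (tl (answer w))"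
    unfolding rats_code_def
    by (rule exI[of _ gs]) (use D_pos in \<open>auto simp: gs_def answer_def o_def\<close>)
  then show ?thesis by (simp add: solution_def answer_def)
qed

lemma solves:
  assumes I: "I \<in> mcmix_instances" "dimen I = n"
    and code: "\<And>k. k < 4 * n + 1 \<Longrightarrow>
      of_rat ((demand I @ capacity I @ [obj_w I] @ obj_y I @ obj_x I) ! k) = real_data k"
  shows "unbounded \<Longrightarrow> mcmix_solves I Unbounded"
    and "\<not> unbounded \<Longrightarrow> k < 2 * n + 1 \<Longrightarrow>
      (\<And>k'. k' < 2 * n + 1 \<Longrightarrow> total (prepared n k) n \<le> total (prepared n k') n) \<Longrightarrow>
      mcmix_solves I (solution (prepared n k))"
proof -
  define ql cl :: "real list" where "ql = map of_rat (demand I)" and "cl = map of_rat (capacity I)"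
  define a where "a = real_of_int A / of_int D"
  define b' e' where "b' i = real_of_int (b i) / of_int D" and "e' i = real_of_int (e i) / of_int D" for i
  have D: "0 < real_of_int D" using D_pos by simp
  have len: "length (demand I) = n" "length (capacity I) = n" "length (obj_y I) = n" "length (obj_x I) = n"
    using I by (auto simp: mcmix_instances_def)
  have qi: "ql ! i = of_int (q i) / of_int D" if "i < n" for i
    using code[of i] that len by (simp add: ql_def nth_append real_data_def q_def)
  have ci: "cl ! i = of_int (Z (n + i)) / of_int D" if "i < n" for i
    using code[of "n + i"] that len by (simp add: cl_def nth_append real_data_def)
  have ri: "ql ! i - cl ! i = of_int (r i) / of_int D" if "i < n" for i
    using qi[OF that] ci[OF that] by (simp add: r_def q_def diff_divide_distrib)
  have ai: "of_rat (obj_w I) = a"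
    using code[of "2 * n"] len by (simp add: nth_append real_data_def a_def A_def)
  have bi: "of_rat (obj_y I ! i) = b' i" if "i < n" for i
    using code[of "2 * n + 1 + i"] that len by (simp add: nth_append real_data_def b'_def b_def)
  have ei: "of_rat (obj_x I ! i) = e' i" if "i < n" for i
    using code[of "3 * n + 1 + i"] that len by (simp add: nth_append real_data_def e'_def e_def)
  have feas: "mcmix_feasible I = P_MCMIX n ql cl"
    by (simp add: mcmix_feasible_def I ql_def cl_def)
  have obj: "mcmix_objective I = lin_obj n a b' e'"
    by (auto simp: fun_eq_iff lin_obj_def I ai bi ei)
  have red: "reduced n (\<lambda>i. ql ! i) (\<lambda>i. ql ! i - cl ! i) a b' e' (of_int w / of_int D) =
      of_int (total w n) / of_int D ^ 2" for w
    unfolding reduced_total[symmetric] by (simp add: reduced_def a_def b'_def e'_def ri) (simp add: qi)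
  have sum_b: "(\<Sum>i<n. b' i) = of_int (\<Sum>i<n. b i) / of_int D"
    by (simp add: b'_def sum_divide_distrib)
  have unb: "unbounded \<longleftrightarrow> a < 0 \<or> (\<exists>i<n. b' i < 0) \<or> a > (\<Sum>i<n. b' i)"
  proof -
    have "a > (\<Sum>i<n. b' i) \<longleftrightarrow> A > (\<Sum>i<n. b i)"
      unfolding sum_b unfolding a_def using D by (simp add: divide_less_cancel del: of_int_sum)
    moreover have "a < 0 \<longleftrightarrow> A < 0" "b' i < 0 \<longleftrightarrow> b i < 0" for i
      using D_pos by (simp_all add: a_def b'_def divide_less_0_iff)
    ultimately show ?thesis by (simp add: unbounded_def)
  qed
  show "mcmix_solves I Unbounded" if unbounded
    using lin_obj_unbounded that unfolding mcmix_solves.simps feas obj unb by blast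
  show "mcmix_solves I (solution (prepared n k))"
    if nu: "\<not> unbounded" and k: "k < 2 * n + 1"
      and min: "\<And>k'. k' < 2 * n + 1 \<Longrightarrow> total (prepared n k) n \<le> total (prepared n k') n"
  proof -
    define w where "w = prepared n k"
    define s :: "real \<times> real list \<times> real list" where
      "s = (of_int w / of_int D, map (\<lambda>i. of_int (y_opt w i) / of_int D) [0..<n],
        map (\<lambda>i. of_int (x_opt w i)) [0..<n])"
    have a: "0 \<le> a" "a \<le> (\<Sum>i<n. b' i)" and b: "\<And>i. i < n \<Longrightarrow> 0 \<le> b' i"
      using nu unfolding unb by auto
    have s_feas: "s \<in> P_MCMIX n ql cl"
    proof -
      have "0 \<le> y_opt w i" for i by (simp add: y_opt_def y0_def y1_def)
      moreover have "ql ! i - cl ! i * of_int (x_opt w i) - of_int (y_opt w i) / of_int D \<le> of_int w / of_int D"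
        if i: "i < n" for i
      proof -
        have "q i - Z (n + i) * x_opt w i - y_opt w i \<le> w"
          by (auto simp: x_opt_def y_opt_def y0_def y1_def r_def q_def max_def)
        then have "real_of_int (q i - Z (n + i) * x_opt w i - y_opt w i) / of_int D \<le> of_int w / of_int D"
          using D by (simp add: divide_le_cancel del: of_int_diff of_int_mult)
        then show ?thesis by (simp add: qi ci i diff_divide_distrib)
      qed
      ultimately show ?thesis using D by (simp add: s_def P_MCMIX_def x_opt_def)
    qed
    have s_obj: "lin_obj n a b' e' s = of_int (total w n) / of_int D ^ 2"
    proof -
      have "b' i * (of_int (y_opt w i) / of_int D) + e' i * of_int (x_opt w i) = of_int (item w i) / of_int D ^ 2"
        for i
      proof (cases "pick w i")
        case True
        then have "item w i = cost1 w i" by (simp add: item_def pick_def)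
        then show ?thesis using D True
          by (simp add: x_opt_def y_opt_def cost1_def b'_def e'_def power2_eq_square field_simps)
      next
        case False
        then have "item w i = cost0 w i" by (simp add: item_def pick_def)
        then show ?thesis using D False
          by (simp add: x_opt_def y_opt_def cost0_def b'_def e'_def power2_eq_square field_simps)
      qed
      moreover have "a * (of_int w / of_int D) = of_int (A * w) / of_int D ^ 2"
        by (simp add: a_def power2_eq_square)
      ultimately show ?thesis
        by (simp add: lin_obj_def s_def total_def add_divide_distrib sum_divide_distrib sum.distrib[symmetric]
            add.assoc)
    qed
    \<comment> \<open>The chain is: value of \<open>s\<close>, total of the best candidate, total of
      candidate \<open>k'\<close>, \<open>reduced\<close> at \<open>v\<close>, value of
      \<open>z\<close>.\<close>
    have "lin_obj n a b' e' s \<le> lin_obj n a b' e' z" if z: "z \<in> P_MCMIX n ql cl" for z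
    proof -
      obtain v y x where zv: "z = (v, y, x)" by (cases z)
      have "\<exists>k'<2 * n + 1. reduced n (\<lambda>i. ql ! i) (\<lambda>i. ql ! i - cl ! i) a b' e'
          (of_int (prepared n k') / of_int D)
        \<le> reduced n (\<lambda>i. ql ! i) (\<lambda>i. ql ! i - cl ! i) a b' e' v"
      proof (cases "n = 0")
        case True
        \<comment> \<open>For \<open>n = 0\<close> the bounds on \<open>a\<close> force
          \<open>a = 0\<close>, so any candidate will do, and address 0 supplies one.\<close>
        then show ?thesis using a by (auto simp: reduced_def)
      next
        case False
        then obtain u where u: "u \<in> (\<lambda>i. ql ! i) ` {..<n} \<union> (\<lambda>i. ql ! i - cl ! i) ` {..<n}"
          and le: "reduced n (\<lambda>i. ql ! i) (\<lambda>i. ql ! i - cl ! i) a b' e' u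
            \<le> reduced n (\<lambda>i. ql ! i) (\<lambda>i. ql ! i - cl ! i) a b' e' v"
          using reduced_minimizer[OF a b] by blast
        from u obtain i where i: "i < n" "u = ql ! i \<or> u = ql ! i - cl ! i" by auto
        have "prepared n i = q i" "prepared n (n + i) = r i"
          using i by (auto simp: prepared_def q_def)
        then have "u = of_int (prepared n i) / of_int D \<or> u = of_int (prepared n (n + i)) / of_int D"
          using i qi ri by auto
        moreover have "i < 2 * n + 1" "n + i < 2 * n + 1" using i by auto
        ultimately obtain k' where "k' < 2 * n + 1" "u = of_int (prepared n k') / of_int D" by blast
        then show ?thesis using le by blast
      qed
      then obtain k' where k': "k' < 2 * n + 1"
        and "of_int (total (prepared n k') n) / of_int D ^ 2 \<le>
          reduced n (\<lambda>i. ql ! i) (\<lambda>i. ql ! i - cl ! i) a b' e' v"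
        unfolding red by blast
      moreover have "of_int (total w n) / real_of_int D ^ 2 \<le> of_int (total (prepared n k') n) / of_int D ^ 2"
        using min[OF k'] D by (simp add: w_def divide_right_mono)
      moreover have "reduced n (\<lambda>i. ql ! i) (\<lambda>i. ql ! i - cl ! i) a b' e' v \<le> lin_obj n a b' e' z"
        using z unfolding zv by (intro reduced_le_lin_obj b)
      ultimately show ?thesis unfolding s_obj by linarith
    qed
    moreover have "(of_rat (Fract w D), map of_rat (map (\<lambda>i. Fract (y_opt w i) D) [0..<n]),
        map of_rat (map (\<lambda>i. Fract (x_opt w i) 1) [0..<n])) = s"
      using D_pos by (simp add: s_def of_rat_rat)
    ultimately show ?thesis
      using s_feas by (simp add: solution_def w_def[symmetric] Let_def feas obj)
  qed
qed

end

section \<open>Assembling the program and its time bound\<close>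

lemma ht_program:
  assumes len: "length fs = 4 * n + 1" and pos: "\<forall>(a, d)\<in>set fs. d > 0"
    and S: "S = code_size (int n # flat fs)" and B: "B = 2 ^ (3 * S + 5)"
    and Z: "Z = num fs (length fs)" and D: "D = den fs (length fs)"
  shows "scaled_data n S Z D (2 ^ S) B"
    and "ht S B (\<lambda>(X, inp, out). X = (\<lambda>_. 0) \<and> inp = int n # flat fs \<and> out = []) mcmix_program
     (\<lambda>(X, inp, out). if scaled_data.unbounded n Z then out = [0] else
        \<exists>k<2 * n + 1. out = scaled_data.answer n Z D (scaled_data.prepared n Z n k) \<and>
          (\<forall>k'<2 * n + 1. scaled_data.total n Z D (scaled_data.prepared n Z n k) n
             \<le> scaled_data.total n Z D (scaled_data.prepared n Z n k') n))"
proof -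
  have flatS: "code_size (flat fs) \<le> S" by (simp add: S code_size_def)
  then have pow: "(2 :: int) ^ code_size (flat fs) \<le> 2 ^ S" by (intro power_increasing) auto
  have num_le: "\<bar>num fs k j\<bar> \<le> 2 ^ S" if "k \<le> length fs" for k j
    unfolding num_def by (rule order.trans[OF abs_prod_le_power2[OF that] pow]) auto
  have den_le: "\<bar>den fs k\<bar> \<le> 2 ^ S" if "k \<le> length fs" for k
    unfolding den_def by (rule order.trans[OF abs_prod_le_power2[OF that] pow]) auto
  \<comment> \<open>Every input integer has size at least 1, so the input size also bounds the
    number of iterations of each loop.\<close>
  have nS: "4 * n + 1 \<le> S"
    using length_le_code_size[of "int n # flat fs"] by (simp add: S length_flat len)
  have "S < 2 ^ S" by simp
  then have Sp: "int S \<le> 2 ^ S" by (simp add: less_imp_le flip: of_nat_power)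
  have nS': "int (4 * n + 1) \<le> 2 ^ S" using nS Sp by linarith
  have B': "B = 32 * (2 ^ S) ^ 3" by (simp add: B power_add power_mult mult.commute)
  show data: "scaled_data n S Z D (2 ^ S) B"
  proof
    show "\<bar>Z k\<bar> \<le> 2 ^ S" for k using num_le by (simp add: Z)
    show "0 < D" unfolding D using den_pos pos by blast
    show "D \<le> 2 ^ S" using den_le[of "length fs"] by (simp add: D)
  qed (use nS nS' B' in auto)
  then interpret scaled_data n S Z D "2 ^ S" B .
  have "2 ^ S \<le> B" using linear_le_B(1) M_ge_1 by linarith
  then have "ht S B (\<lambda>(X, inp, out). X = (\<lambda>_. 0) \<and> inp = int n # flat fs \<and> out = []) read_instance
     (\<lambda>(X, inp, out). X rN = int n \<and> X rOne = 1 \<and> X rZero = 0 \<and> X rFlag = 0 \<and> X rSum = 0 \<and>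
        X rD = den fs (4 * n + 1) \<and> arr X (num fs (4 * n + 1)) (4 * n + 1) \<and> out = [])"
  proof (intro ht_read_instance[OF len])
    show "int (4 * n + 1) \<le> B" "4 \<le> B" "4 * n + 1 \<le> S"
      using nS nS' \<open>2 ^ S \<le> B\<close> linear_le_B(3) by linarith+
    show "\<bar>num fs k j\<bar> \<le> B" "\<bar>den fs k\<bar> \<le> B" if "k \<le> 4 * n + 1" for k j
      using num_le[of k j] den_le[of k] that len \<open>2 ^ S \<le> B\<close> by simp_all
  qed
  then have "ht S B (\<lambda>(X, inp, out). X = (\<lambda>_. 0) \<and> inp = int n # flat fs \<and> out = []) read_instance
     (\<lambda>(X, inp, out). base X \<and> X rFlag = 0 \<and> X rSum = 0 \<and> arr X Z (4 * n + 1) \<and> out = [])"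
  proof (rule ht_conseq)
    have "Suc (4 * n) = length fs" using len by simp
    then have "num fs (Suc (4 * n)) = Z" "den fs (Suc (4 * n)) = D" by (simp_all add: Z D)
    then show "case s of (X, inp, out) \<Rightarrow> base X \<and> X rFlag = 0 \<and> X rSum = 0 \<and> arr X Z (4 * n + 1) \<and> out = []"
      if "case s of (X, inp, out) \<Rightarrow> X rN = int n \<and> X rOne = 1 \<and> X rZero = 0 \<and> X rFlag = 0 \<and>
        X rSum = 0 \<and> X rD = den fs (4 * n + 1) \<and> arr X (num fs (4 * n + 1)) (4 * n + 1) \<and> out = []" for s
      using that by (simp add: base_def split: prod.splits)
  qed
  from ht_Seq[OF this ht_Seq[OF ht_prepare[folded unbounded_def] ht_optimize]]
  show "ht S B (\<lambda>(X, inp, out). X = (\<lambda>_. 0) \<and> inp = int n # flat fs \<and> out = []) mcmix_program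
     (\<lambda>(X, inp, out). if unbounded then out = [0] else
        \<exists>k<2 * n + 1. out = answer (prepared n k) \<and>
          (\<forall>k'<2 * n + 1. total (prepared n k) n \<le> total (prepared n k') n))"
    unfolding mcmix_program_def .
qed

text \<open>Code placed at position 0 ends at position \<open>csize c\<close>, the length of the
  program, and this is where the machine halts.\<close>

lemma ht_ram_computes:
  assumes "ht N B P c Q" "P ((\<lambda>_. 0), inp, [])" "0 \<le> B" "\<forall>v\<in>set inp. \<bar>v\<bar> \<le> B"
  shows "\<exists>t X inp' out. ram_computes (compile 0 c) inp t out \<and>
    t \<le> steps N c * (2 * int_size B) \<and> Q (X, inp', out)"
proof -
  have "code_at (compile 0 c) 0 (compile 0 c)" by (auto simp: code_at_def)
  moreover have "bounded B ((\<lambda>_. 0), inp, [])" using assms by simp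
  ultimately obtain s' where
    "reaches (compile 0 c) B (0, (\<lambda>_. 0), inp, []) (steps N c) (0 + csize c, s')" "Q s'"
    using assms(1,2) unfolding ht_def by blast
  then show ?thesis
    unfolding reaches_def ram_computes_def by (cases s') (auto, blast)
qed

theorem corollary5p42:
  "poly_time_solvable mcmix_instances mcmix_instance_code mcmix_answer_code mcmix_solves"
proof -
  obtain sp where sp: "\<And>N. steps N mcmix_program = poly sp N" using steps_poly by blast
  \<comment> \<open>The linear factor is \<open>2 * int_size B\<close>: the power of two with
    exponent \<open>3 * S + 5\<close> has size \<open>3 * S + 7\<close>.\<close>
  define p where "p = sp * [:14, 6:]"
  have "\<exists>t out b. ram_computes (compile 0 mcmix_program) inp t out \<and> t \<le> poly p (code_size inp) \<and>
      mcmix_answer_code b out \<and> mcmix_solves I b"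
    if I: "I \<in> mcmix_instances" and code: "mcmix_instance_code I inp" for I inp
  proof -
    define n where "n = dimen I"
    obtain fs where pos: "\<forall>(a, d)\<in>set fs. d > 0"
      and rs: "demand I @ capacity I @ [obj_w I] @ obj_y I @ obj_x I = map (\<lambda>(a, d). Fract a d) fs"
      and inp: "inp = int n # flat fs"
      using code by (auto simp: mcmix_instance_code_def rats_code_def flat_def n_def)
    from arg_cong[OF rs, of length] have len: "length fs = 4 * n + 1"
      using I by (simp add: mcmix_instances_def n_def)
    define S where "S = code_size inp"
    define B :: int where "B = 2 ^ (3 * S + 5)"
    define Z where "Z = num fs (length fs)"
    define D where "D = den fs (length fs)"
    note prems = len pos S_def[unfolded inp] B_def Z_def D_def
    interpret scaled_data n S Z D "2 ^ S" B using ht_program(1)[OF prems] .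
    have inp_le: "\<bar>v\<bar> \<le> B" if "v \<in> set inp" for v
    proof -
      have "\<bar>v\<bar> \<le> 2 ^ int_size v" by (rule abs_le_power2_int_size)
      also have "\<dots> \<le> B"
        unfolding B_def using int_size_le_code_size[OF that]
        by (intro power_increasing) (auto simp: S_def)
      finally show ?thesis .
    qed
    obtain t out where run: "ram_computes (compile 0 mcmix_program) inp t out"
        "t \<le> steps S mcmix_program * (2 * int_size B)"
      and out: "if unbounded then out = [0] else \<exists>k<2 * n + 1. out = answer (prepared n k) \<and>
          (\<forall>k'<2 * n + 1. total (prepared n k) n \<le> total (prepared n k') n)"
      using ht_ram_computes[OF ht_program(2)[OF prems], of inp] inp_le const_le_B by (auto simp: inp)
    have "2 * int_size B = 14 + S * 6" by (simp add: B_def int_size_power2)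
    then have time: "t \<le> poly p (code_size inp)"
      using run(2) by (simp add: p_def sp S_def algebra_simps)
    have data: "of_rat ((demand I @ capacity I @ [obj_w I] @ obj_y I @ obj_x I) ! k) = real_data k"
      if "k < 4 * n + 1" for k
      unfolding rs real_data_def using that pos num_over_den[of k fs]
      by (simp add: Z_def D_def len split_beta)
    have "\<exists>b. mcmix_answer_code b out \<and> mcmix_solves I b"
    proof (cases unbounded)
      case True
      then have "mcmix_answer_code Unbounded out" using out by simp
      moreover have "mcmix_solves I Unbounded"
        by (rule solves(1)[OF I n_def[symmetric] _ True]) (rule data)
      ultimately show ?thesis by blast
    next
      case False
      then obtain k where k: "k < 2 * n + 1" "out = answer (prepared n k)"
        "\<And>k'. k' < 2 * n + 1 \<Longrightarrow> total (prepared n k) n \<le> total (prepared n k') n"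
        using out by auto
      have "mcmix_solves I (solution (prepared n k))"
        by (rule solves(2)[OF I n_def[symmetric] _ False k(1)]) (fact data, fact k(3))
      then show ?thesis using solution_code k(2) by blast
    qed
    then show ?thesis using run(1) time by blast
  qed
  then show ?thesis unfolding poly_time_solvable_def by blast
qed

end
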